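(* Let $(E,\|\cdot\|)$ be a random normed module over $\mathbb{K}$ with base $(\Omega,\mathcal{F},P)$, let $G$ be a random sequentially compact $L^{0}$-convex subset of $E$, and let $F:G\rightarrow 2^{G}\setminus\{\emptyset\}$ be a $\sigma$-stable $\mathcal{T}_{c}$-upper semicontinuous set-valued mapping such that $F(x)$ is closed and $L^{0}$-convex for each $x\in G$. Then $F$ has a fixed point, i.e. there exists $x_0\in G$ with $x_{0}\in F(x_{0})$.
   Context: Basic notation. $(\Omega,\mathcal{F},P)$ is a probability space; $\mathbb{K}$ is $\mathbb{R}$ or $\mathbb{C}$; $\mathbb{N}$ is the set of positive integers. $L^{0}(\mathcal{F},\mathbb{K})$ is the algebra of (a.s.-equality) equivalence classes of $\mathbb{K}$-valued random variables, $L^0(\mathcal{F}):=L^0(\mathcal{F},\mathbb{R})$, and $L^{0}(\mathcal{F},\mathbb{N})$ is the set of equivalence classes of $\mathbb{N}$-valued random variables. $\xi\le\eta$ in $L^0(\mathcal F)$ means $\xi(\omega)\le\eta(\omega)$ a.s. $L^0_+(\mathcal{F})=\{\xi\in L^0(\mathcal{F}):\xi\ge 0\}$. $B_{\mathcal{F}}$ is the measure algebra of classes $a=[A]$, $A\in\mathcal{F}$, modulo null sets, a complete Boolean algebra with $1=[\Omega]$, $0=[\emptyset]$. For $a=[A]\in B_{\mathcal F}$, $I_a$ is the class of the characteristic function of $A$, and "$\xi<\eta$ on $a$" means $\xi(\omega)<\eta(\omega)$ for almost all $\omega\in A$. $L^0_{++}(\mathcal{F})=\{\xi\in L^0(\mathcal{F}):\xi>0\text{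 on }1\}$. $(\xi=\eta)\in B_{\mathcal F}$ is the class of $\{\omega:\xi(\omega)=\eta(\omega)\}$. $\{a_n,n\in\mathbb{N}\}\in p(1)$ (a countable partition of unity) means $a_n\in B_{\mathcal F}$, $a_i\wedge a_j=0$ for $i\ne j$ and $\bigvee_n a_n=1$ (some $a_n$ may be $0$). Random normed module ($RN$ module): a left module $E$ over the algebra $L^0(\mathcal{F},\mathbb{K})$ with a mapping $\|\cdot\|:E\to L^0_+(\mathcal{F})$ such that $\|\xi x\|=|\xi|\|x\|$, $\|x+y\|\le\|x\|+\|y\|$, and $\|x\|=0$ implies $x=\theta$ (the null element), for all $\xi\in L^0(\mathcal{F},\mathbb{K})$, $x,y\in E$. Topologies on $E$. The $(\varepsilon,\lambda)$-topology $\mathcal{T}_{\varepsilon,\lambda}$ is the metrizable linear topology with local base at $\theta$ given by $N_\theta(\varepsilon,\lambda)=\{x\in E:P\{\omega:\|x\|(\omega)<\varepsilon\}>1-\lambda\}$, for real $\varepsilon>0$, $0<\lambda<1$ (so $x_n\to x$ iff $\|x_n-x\|\to0$ in probability). The locally $L^0$-convex topology $\mathcal{T}_c$ is the topology with base $\{B(x,r):x\in E,\ r\in L^0_{++}(\mathcal{F})\}$, where $B(x,r)=\{y\in E:\|y-x\|<r\text{ on }1\}$. A nonempty $G\subseteq E$ is $L^0$-convex if $\xi x+(1-\xi)y\in G$ for all $x,y\in G$ and $\xi\in L^0_+(\mathcal{F})$ with $0\le\xi\le1$. A nonempty $G\subseteq E$ is $\sigma$-stable if for each sequence $\{x_n\}$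 in $G$ and each $\{a_n,n\in\mathbb{N}\}\in p(1)$ there is $x\in G$ with $I_{a_n}x=I_{a_n}x_n$ for all $n$; such $x$ is unique and denoted $\sum_{n=1}^\infty I_{a_n}x_n$. For nonempty subsets $G_n$ of a $\sigma$-stable set, $\sum_{n=1}^{\infty}I_{a_n}G_n:=\{\sum_{n=1}^{\infty}I_{a_n}x_n:x_n\in G_n\ \forall n\}$. Random sequential compactness. Let $G$ be a nonempty subset of $E$ contained in a $\sigma$-stable subset $H$ of $E$. A random subsequence of a sequence $\{x_n\}$ in $G$ is a sequence $\{y_k\}$ in $H$ of the form $y_k=x_{n_k}:=\sum_{l=1}^\infty I_{(n_k=l)}x_l$, where $\{n_k,k\in\mathbb{N}\}$ is a sequence in $L^0(\mathcal{F},\mathbb{N})$ with $n_k<n_{k+1}$ on $1$ for all $k$. $G$ is random sequentially compact if every sequence in $G$ has a random subsequence that converges in $\mathcal{T}_{\varepsilon,\lambda}$ to some element of $G$. Set-valued mappings. For $F:X\to 2^Y\setminus\{\emptyset\}$ with $X,Y$ nonempty subsets of $RN$ modules over $\mathbb K$ with the same base, put $F(S)=\bigcup_{x\in S}F(x)$ for $S\subseteq X$. $F$ is $\sigma$-stable if $X$ and $F(X)$ are $\sigma$-stable and $F(\sum_{n=1}^\infty I_{a_n}x_n)=\sum_{n=1}^\infty I_{a_n}F(x_n)$ for every sequence $\{x_n\}$ in $X$ and every $\{a_n,n\in\mathbb{N}\}\in p(1)$. $F$ is $\mathcal{T}_c$-upper semicontinuous (on $X$) if for every $x_0\in X$ and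 every $\mathcal{T}_c$-neighborhood $U$ of the set $F(x_0)$ there is a $\mathcal{T}_c$-neighborhood $V$ of $x_0$ with $F(V\cap X)\subseteq U$. Closedness convention: each $F(x)$ is $\sigma$-stable because $F$ is, and a $\sigma$-stable set has the same closure under $\mathcal{T}_{\varepsilon,\lambda}$ and $\mathcal{T}_c$; "closed" means closed under either topology. *)

theory Defs
  imports "HOL-Probability.Probability" "HOL-Algebra.Module"
begin

text \<open>
  Throughout, \<open>M\<close> is the base probability space and the scalar field is a type \<open>'k\<close> of sort
  \<open>{real_normed_field, second_countable_topology}\<close>.  The instances \<open>real\<close> and \<open>complex\<close> are the
  intended ones; by the Gelfand-Mazur theorem they are the only ones up to isometric isomorphism.

  Sequences are indexed by \<open>nat\<close> starting from \<open>0\<close>, and accordingly random indices take values in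
  \<open>nat\<close> including \<open>0\<close>; this only shifts the usual indexing by the positive integers.
\<close>

section \<open>Equivalence classes of random variables\<close>

definition L0_rel :: "'a measure \<Rightarrow> 'b measure \<Rightarrow> (('a \<Rightarrow> 'b) \<times> ('a \<Rightarrow> 'b)) set" where
  "L0_rel M N = {(f, g). f \<in> measurable M N \<and> g \<in> measurable M N \<and> (AE \<omega> in M. f \<omega> = g \<omega>)}"

definition L0 :: "'a measure \<Rightarrow> 'b measure \<Rightarrow> ('a \<Rightarrow> 'b) set set" where
  "L0 M N = measurable M N // L0_rel M N"

definition L0_class :: "'a measure \<Rightarrow> 'b measure \<Rightarrow> ('a \<Rightarrow> 'b) \<Rightarrow> ('a \<Rightarrow> 'b) set" where
  "L0_class M N f = L0_rel M N `` {f}"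

text \<open>An arbitrary representative of a class.  Everything defined through \<open>rep\<close> below depends on the
  representative only up to a null set.\<close>

definition rep :: "'c set \<Rightarrow> 'c" where
  "rep X = (SOME f. f \<in> X)"

definition L0_map ::
  "'a measure \<Rightarrow> ('b \<Rightarrow> 'c::topological_space) \<Rightarrow> ('a \<Rightarrow> 'b) set \<Rightarrow> ('a \<Rightarrow> 'c) set" where
  "L0_map M h X = L0_class M borel (\<lambda>\<omega>. h (rep X \<omega>))"

definition L0_map2 ::
  "'a measure \<Rightarrow> ('b \<Rightarrow> 'b \<Rightarrow> 'b::topological_space) \<Rightarrow> ('a \<Rightarrow> 'b) set \<Rightarrow> ('a \<Rightarrow> 'b) set \<Rightarrow> ('a \<Rightarrow> 'b) set"
  where "L0_map2 M h X Y = L0_class M borel (\<lambda>\<omega>. h (rep X \<omega>) (rep Y \<omega>))"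

definition L0_ring ::
  "'a measure \<Rightarrow> ('a \<Rightarrow> 'k::{real_normed_field, second_countable_topology}) set ring" where
  "L0_ring M = \<lparr>carrier = L0 M borel, mult = L0_map2 M (*), one = L0_class M borel (\<lambda>_. 1),
     zero = L0_class M borel (\<lambda>_. 0), add = L0_map2 M (+)\<rparr>"

definition L0_le :: "'a measure \<Rightarrow> ('a \<Rightarrow> 'b::ord) set \<Rightarrow> ('a \<Rightarrow> 'b) set \<Rightarrow> bool" where
  "L0_le M X Y \<longleftrightarrow> (AE \<omega> in M. rep X \<omega> \<le> rep Y \<omega>)"

text \<open>This is ``\<open>X < Y\<close> on \<open>1\<close>'', not the strict part of \<open>L0_le\<close>.\<close>

definition L0_less :: "'a measure \<Rightarrow> ('a \<Rightarrow> 'b::ord) set \<Rightarrow> ('a \<Rightarrow> 'b) set \<Rightarrow> bool" where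
  "L0_less M X Y \<longleftrightarrow> (AE \<omega> in M. rep X \<omega> < rep Y \<omega>)"

definition L0_nonneg :: "'a measure \<Rightarrow> ('a \<Rightarrow> real) set set" where
  "L0_nonneg M = {X \<in> L0 M borel. L0_le M \<zero>\<^bsub>L0_ring M\<^esub> X}"

definition L0_pos :: "'a measure \<Rightarrow> ('a \<Rightarrow> real) set set" where
  "L0_pos M = {X \<in> L0 M borel. L0_less M \<zero>\<^bsub>L0_ring M\<^esub> X}"

section \<open>The measure algebra\<close>

definition MA_rel :: "'a measure \<Rightarrow> ('a set \<times> 'a set) set" where
  "MA_rel M = {(A, B). A \<in> sets M \<and> B \<in> sets M \<and> (AE \<omega> in M. \<omega> \<in> A \<longleftrightarrow> \<omega> \<in> B)}"

definition measure_algebra :: "'a measure \<Rightarrow> 'a set set set" where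
  "measure_algebra M = sets M // MA_rel M"

definition MA_class :: "'a measure \<Rightarrow> 'a set \<Rightarrow> 'a set set" where
  "MA_class M A = MA_rel M `` {A}"

text \<open>The meet and the countable join in the measure algebra are the classes of the intersection and
  of the union of representatives.\<close>

definition partition_of_unity :: "'a measure \<Rightarrow> (nat \<Rightarrow> 'a set set) \<Rightarrow> bool" where
  "partition_of_unity M a \<longleftrightarrow>
     (\<forall>n. a n \<in> measure_algebra M) \<and>
     (\<forall>i j. i \<noteq> j \<longrightarrow> MA_class M (rep (a i) \<inter> rep (a j)) = MA_class M {}) \<and>
     MA_class M (\<Union>n. rep (a n)) = MA_class M (space M)"

definition L0_ind ::
  "'a measure \<Rightarrow> 'a set set \<Rightarrow> ('a \<Rightarrow> 'k::{real_normed_field, second_countable_topology}) set" where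
  "L0_ind M a = L0_class M borel (indicator (rep a))"

definition L0_eq_event :: "'a measure \<Rightarrow> ('a \<Rightarrow> 'b) set \<Rightarrow> 'b \<Rightarrow> 'a set set" where
  "L0_eq_event M X c = MA_class M {\<omega> \<in> space M. rep X \<omega> = c}"

section \<open>Random normed modules\<close>

record ('a, 'k, 'e) rn_module = "(('a \<Rightarrow> 'k) set, 'e) module" +
  rnorm :: "'e \<Rightarrow> ('a \<Rightarrow> real) set"

locale rn_module = prob?: prob_space M + Module.module "L0_ring M" E
  for M :: "'a measure"
    and E :: "('a, 'k::{real_normed_field, second_countable_topology}, 'e, 'z) rn_module_scheme"
      (structure) +
  assumes rnorm_nonneg: "x \<in> carrier E \<Longrightarrow> rnorm E x \<in> L0_nonneg M"
    and rnorm_smult: "\<xi> \<in> L0 M borel \<Longrightarrow> x \<in> carrier E \<Longrightarrow>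
      rnorm E (\<xi> \<odot>\<^bsub>E\<^esub> x) = L0_map M norm \<xi> \<otimes>\<^bsub>L0_ring M\<^esub> rnorm E x"
    and rnorm_triangle: "x \<in> carrier E \<Longrightarrow> y \<in> carrier E \<Longrightarrow>
      L0_le M (rnorm E (x \<oplus>\<^bsub>E\<^esub> y)) (rnorm E x \<oplus>\<^bsub>L0_ring M\<^esub> rnorm E y)"
    and rnorm_eq_zero: "x \<in> carrier E \<Longrightarrow> rnorm E x = \<zero>\<^bsub>L0_ring M\<^esub> \<Longrightarrow> x = \<zero>\<^bsub>E\<^esub>"

subsection \<open>The two topologies\<close>

definition el_nhd ::
  "'a measure \<Rightarrow> ('a, 'k, 'e, 'z) rn_module_scheme \<Rightarrow> 'e \<Rightarrow> real \<Rightarrow> real \<Rightarrow> 'e set" where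
  "el_nhd M E x \<epsilon> \<delta> =
     {y \<in> carrier E. measure M {\<omega> \<in> space M. rep (rnorm E (y \<ominus>\<^bsub>E\<^esub> x)) \<omega> < \<epsilon>} > 1 - \<delta>}"

definition el_topology ::
  "'a measure \<Rightarrow> ('a, 'k, 'e, 'z) rn_module_scheme \<Rightarrow> 'e topology" where
  "el_topology M E = topology (\<lambda>U. U \<subseteq> carrier E \<and>
     (\<forall>x\<in>U. \<exists>\<epsilon>>0. \<exists>\<delta>. 0 < \<delta> \<and> \<delta> < 1 \<and> el_nhd M E x \<epsilon> \<delta> \<subseteq> U))"

definition rn_ball ::
  "'a measure \<Rightarrow> ('a, 'k, 'e, 'z) rn_module_scheme \<Rightarrow> 'e \<Rightarrow> ('a \<Rightarrow> real) set \<Rightarrow> 'e set" where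
  "rn_ball M E x r = {y \<in> carrier E. L0_less M (rnorm E (y \<ominus>\<^bsub>E\<^esub> x)) r}"

definition Tc_topology ::
  "'a measure \<Rightarrow> ('a, 'k, 'e, 'z) rn_module_scheme \<Rightarrow> 'e topology" where
  "Tc_topology M E =
     topology_generated_by {rn_ball M E x r | x r. x \<in> carrier E \<and> r \<in> L0_pos M}"

definition set_nhd :: "'e topology \<Rightarrow> 'e set \<Rightarrow> 'e set \<Rightarrow> bool" where
  "set_nhd T S U \<longleftrightarrow> U \<subseteq> topspace T \<and> (\<exists>W. openin T W \<and> S \<subseteq> W \<and> W \<subseteq> U)"

subsection \<open>Convexity, stability and random sequential compactness\<close>

definition L0_convex ::
  "'a measure \<Rightarrow> ('a, 'k::{real_normed_field, second_countable_topology}, 'e, 'z) rn_module_scheme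
     \<Rightarrow> 'e set \<Rightarrow> bool" where
  "L0_convex M E G \<longleftrightarrow> G \<noteq> {} \<and> G \<subseteq> carrier E \<and>
     (\<forall>x\<in>G. \<forall>y\<in>G. \<forall>\<xi>\<in>L0_nonneg M. L0_le M \<xi> \<one>\<^bsub>L0_ring M\<^esub> \<longrightarrow>
        L0_map M of_real \<xi> \<odot>\<^bsub>E\<^esub> x \<oplus>\<^bsub>E\<^esub>
          (\<one>\<^bsub>L0_ring M\<^esub> \<ominus>\<^bsub>L0_ring M\<^esub> L0_map M of_real \<xi>) \<odot>\<^bsub>E\<^esub> y \<in> G)"

definition sigma_stable ::
  "'a measure \<Rightarrow> ('a, 'k::{real_normed_field, second_countable_topology}, 'e, 'z) rn_module_scheme
     \<Rightarrow> 'e set \<Rightarrow> bool" where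
  "sigma_stable M E G \<longleftrightarrow> G \<noteq> {} \<and> G \<subseteq> carrier E \<and>
     (\<forall>x a. (\<forall>n. x n \<in> G) \<and> partition_of_unity M a \<longrightarrow>
        (\<exists>z\<in>G. \<forall>n. L0_ind M (a n) \<odot>\<^bsub>E\<^esub> z = L0_ind M (a n) \<odot>\<^bsub>E\<^esub> x n))"

text \<open>The countable concatenation \<open>\<Sum>n. I\<^bsub>a n\<^esub> x n\<close>; meaningful when such an element exists, which is
  the case if the \<open>x n\<close> lie in a \<open>\<sigma>\<close>-stable set (for uniqueness see \<open>glue_unique\<close>).\<close>

definition glue ::
  "'a measure \<Rightarrow> ('a, 'k::{real_normed_field, second_countable_topology}, 'e, 'z) rn_module_scheme
     \<Rightarrow> (nat \<Rightarrow> 'a set set) \<Rightarrow> (nat \<Rightarrow> 'e) \<Rightarrow> 'e" where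
  "glue M E a x =
     (THE z. z \<in> carrier E \<and> (\<forall>n. L0_ind M (a n) \<odot>\<^bsub>E\<^esub> z = L0_ind M (a n) \<odot>\<^bsub>E\<^esub> x n))"

definition set_glue ::
  "'a measure \<Rightarrow> ('a, 'k::{real_normed_field, second_countable_topology}, 'e, 'z) rn_module_scheme
     \<Rightarrow> (nat \<Rightarrow> 'a set set) \<Rightarrow> (nat \<Rightarrow> 'e set) \<Rightarrow> 'e set" where
  "set_glue M E a S = {glue M E a x | x. \<forall>n. x n \<in> S n}"

definition random_subseq ::
  "'a measure \<Rightarrow> ('a, 'k::{real_normed_field, second_countable_topology}, 'e, 'z) rn_module_scheme
     \<Rightarrow> (nat \<Rightarrow> 'e) \<Rightarrow> (nat \<Rightarrow> 'e) \<Rightarrow> bool" where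
  "random_subseq M E x y \<longleftrightarrow>
     (\<exists>n. (\<forall>k. n k \<in> L0 M (count_space UNIV)) \<and> (\<forall>k. L0_less M (n k) (n (Suc k))) \<and>
        (\<forall>k. y k = glue M E (L0_eq_event M (n k)) x))"

definition random_seq_compact ::
  "'a measure \<Rightarrow> ('a, 'k::{real_normed_field, second_countable_topology}, 'e, 'z) rn_module_scheme
     \<Rightarrow> 'e set \<Rightarrow> bool" where
  "random_seq_compact M E G \<longleftrightarrow> G \<noteq> {} \<and>
     (\<exists>H. sigma_stable M E H \<and> G \<subseteq> H \<and>
        (\<forall>x. (\<forall>n. x n \<in> G) \<longrightarrow>
           (\<exists>y. random_subseq M E x y \<and> (\<forall>k. y k \<in> H) \<and>
             (\<exists>z\<in>G. limitin (el_topology M E) y z sequentially))))"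

subsection \<open>Set-valued mappings\<close>

definition sigma_stable_map ::
  "'a measure \<Rightarrow> ('a, 'k::{real_normed_field, second_countable_topology}, 'e, 'z) rn_module_scheme
     \<Rightarrow> ('a, 'k, 'f, 'y) rn_module_scheme \<Rightarrow> 'e set \<Rightarrow> ('e \<Rightarrow> 'f set) \<Rightarrow> bool" where
  "sigma_stable_map M E E' X F \<longleftrightarrow>
     sigma_stable M E X \<and> sigma_stable M E' (\<Union>x\<in>X. F x) \<and>
     (\<forall>x a. (\<forall>n. x n \<in> X) \<and> partition_of_unity M a \<longrightarrow>
        F (glue M E a x) = set_glue M E' a (\<lambda>n. F (x n)))"

definition Tc_usc ::
  "'a measure \<Rightarrow> ('a, 'k, 'e, 'z) rn_module_scheme
     \<Rightarrow> ('a, 'k, 'f, 'y) rn_module_scheme \<Rightarrow> 'e set \<Rightarrow> ('e \<Rightarrow> 'f set) \<Rightarrow> bool" where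
  "Tc_usc M E E' X F \<longleftrightarrow>
     (\<forall>x\<in>X. \<forall>U. set_nhd (Tc_topology M E') (F x) U \<longrightarrow>
        (\<exists>V. set_nhd (Tc_topology M E) {x} V \<and> (\<Union>v\<in>V \<inter> X. F v) \<subseteq> U))"

section \<open>Well-definedness\<close>

lemma equiv_L0_rel: "equiv (measurable M N) (L0_rel M N)"
proof (intro equivI refl_onI symI transI)
  show "(g, f) \<in> L0_rel M N" if "(f, g) \<in> L0_rel M N" for f g
    using that by (simp add: L0_rel_def eq_commute)
  show "(f, h) \<in> L0_rel M N" if "(f, g) \<in> L0_rel M N" "(g, h) \<in> L0_rel M N" for f g h
  proof -
    have "AE \<omega> in M. f \<omega> = g \<omega>" "AE \<omega> in M. g \<omega> = h \<omega>" using that by (simp_all add: L0_rel_def)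
    then have "AE \<omega> in M. f \<omega> = h \<omega>" by eventually_elim simp
    then show ?thesis using that by (simp add: L0_rel_def)
  qed
qed (simp_all add: L0_rel_def subset_iff)

lemma L0_classI: "f \<in> measurable M N \<Longrightarrow> L0_class M N f \<in> L0 M N"
  unfolding L0_class_def L0_def by (rule quotientI)

lemma L0_class_eq_iff:
  "f \<in> measurable M N \<Longrightarrow> g \<in> measurable M N \<Longrightarrow>
    L0_class M N f = L0_class M N g \<longleftrightarrow> (AE \<omega> in M. f \<omega> = g \<omega>)"
  unfolding L0_class_def by (simp add: eq_equiv_class_iff[OF equiv_L0_rel]) (simp add: L0_rel_def)

lemma rep_class:
  assumes "f \<in> measurable M N"
  shows "rep (L0_class M N f) \<in> measurable M N" "AE \<omega> in M. rep (L0_class M N f) \<omega> = f \<omega>"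
proof -
  have "f \<in> L0_class M N f" using assms by (auto simp: L0_class_def L0_rel_def)
  then have "rep (L0_class M N f) \<in> L0_class M N f" unfolding rep_def some_in_eq by blast
  then have "(f, rep (L0_class M N f)) \<in> L0_rel M N"
    by (simp add: L0_class_def[of M N f] Image_singleton_iff)
  then show "rep (L0_class M N f) \<in> measurable M N" "AE \<omega> in M. rep (L0_class M N f) \<omega> = f \<omega>"
    by (simp_all add: L0_rel_def eq_commute)
qed

lemma L0_rep:
  assumes "X \<in> L0 M N"
  shows "rep X \<in> measurable M N" "L0_class M N (rep X) = X"
proof -
  obtain f where f: "f \<in> measurable M N" "X = L0_class M N f"
    using assms unfolding L0_def L0_class_def by (rule quotientE)
  show "rep X \<in> measurable M N" using rep_class[OF f(1)] f(2) by simp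
  then show "L0_class M N (rep X) = X"
    using rep_class[OF f(1)] f by (simp add: L0_class_eq_iff)
qed

lemma cring_L0_ring:
  "cring (L0_ring M :: ('a \<Rightarrow> 'k::{real_normed_field, second_countable_topology}) set ring)"
proof -
  let ?R = "L0_ring M :: ('a \<Rightarrow> 'k) set ring"
  let ?c = "L0_class M borel :: ('a \<Rightarrow> 'k) \<Rightarrow> _"
  have add: "?c f \<oplus>\<^bsub>?R\<^esub> ?c g = ?c (\<lambda>\<omega>. f \<omega> + g \<omega>)"
    if [measurable]: "f \<in> borel_measurable M" "g \<in> borel_measurable M" for f g
  proof -
    note [measurable] = rep_class(1)[OF that(1)] rep_class(1)[OF that(2)]
    have "AE \<omega> in M. rep (?c f) \<omega> + rep (?c g) \<omega> = f \<omega> + g \<omega>"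
      using rep_class(2)[OF that(1)] rep_class(2)[OF that(2)] by eventually_elim simp
    then show ?thesis by (simp add: L0_ring_def L0_map2_def L0_class_eq_iff)
  qed
  have mult: "?c f \<otimes>\<^bsub>?R\<^esub> ?c g = ?c (\<lambda>\<omega>. f \<omega> * g \<omega>)"
    if [measurable]: "f \<in> borel_measurable M" "g \<in> borel_measurable M" for f g
  proof -
    note [measurable] = rep_class(1)[OF that(1)] rep_class(1)[OF that(2)]
    have "AE \<omega> in M. rep (?c f) \<omega> * rep (?c g) \<omega> = f \<omega> * g \<omega>"
      using rep_class(2)[OF that(1)] rep_class(2)[OF that(2)] by eventually_elim simp
    then show ?thesis by (simp add: L0_ring_def L0_map2_def L0_class_eq_iff)
  qed
  have cE: "\<exists>f. f \<in> borel_measurable M \<and> X = ?c f" if "X \<in> carrier ?R" for X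
    using L0_rep[of X M borel] that by (auto simp: L0_ring_def intro!: exI[of _ "rep X"])
  have cI: "?c f \<in> carrier ?R" if "f \<in> borel_measurable M" for f
    using that by (simp add: L0_ring_def L0_classI)
  have zero: "\<zero>\<^bsub>?R\<^esub> = ?c (\<lambda>_. 0)" and one: "\<one>\<^bsub>?R\<^esub> = ?c (\<lambda>_. 1)"
    by (simp_all add: L0_ring_def)
  have zm: "(\<lambda>_. 0 :: 'k) \<in> borel_measurable M" and om: "(\<lambda>_. 1 :: 'k) \<in> borel_measurable M"
    by simp_all
  note ops = add mult zero one
  note cl = cI borel_measurable_add borel_measurable_times zm om
  show ?thesis
  proof (intro cringI abelian_groupI comm_monoidI)
    fix X assume "X \<in> carrier ?R"
    then obtain f where f: "f \<in> borel_measurable M" and X: "X = ?c f" using cE by blast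
    show "\<zero>\<^bsub>?R\<^esub> \<oplus>\<^bsub>?R\<^esub> X = X" "\<one>\<^bsub>?R\<^esub> \<otimes>\<^bsub>?R\<^esub> X = X"
      unfolding X ops using f by (simp_all add: ops)
    have "?c (\<lambda>\<omega>. - f \<omega>) \<oplus>\<^bsub>?R\<^esub> X = \<zero>\<^bsub>?R\<^esub>" unfolding X using f by (simp add: add zero)
    moreover have "?c (\<lambda>\<omega>. - f \<omega>) \<in> carrier ?R" using f by (intro cI) simp
    ultimately show "\<exists>Y\<in>carrier ?R. Y \<oplus>\<^bsub>?R\<^esub> X = \<zero>\<^bsub>?R\<^esub>" by blast
    fix Y assume "Y \<in> carrier ?R"
    then obtain g where g: "g \<in> borel_measurable M" and Y: "Y = ?c g" using cE by blast
    show "X \<oplus>\<^bsub>?R\<^esub> Y \<in> carrier ?R" "X \<otimes>\<^bsub>?R\<^esub> Y \<in> carrier ?R"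
      unfolding X Y using f g by (simp_all add: ops cl)
    show "X \<oplus>\<^bsub>?R\<^esub> Y = Y \<oplus>\<^bsub>?R\<^esub> X" "X \<otimes>\<^bsub>?R\<^esub> Y = Y \<otimes>\<^bsub>?R\<^esub> X"
      unfolding X Y using f g by (simp_all add: ops add.commute mult.commute)
    fix Z assume "Z \<in> carrier ?R"
    then obtain h where h: "h \<in> borel_measurable M" and Z: "Z = ?c h" using cE by blast
    show "X \<oplus>\<^bsub>?R\<^esub> Y \<oplus>\<^bsub>?R\<^esub> Z = X \<oplus>\<^bsub>?R\<^esub> (Y \<oplus>\<^bsub>?R\<^esub> Z)"
      "X \<otimes>\<^bsub>?R\<^esub> Y \<otimes>\<^bsub>?R\<^esub> Z = X \<otimes>\<^bsub>?R\<^esub> (Y \<otimes>\<^bsub>?R\<^esub> Z)"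
      "(X \<oplus>\<^bsub>?R\<^esub> Y) \<otimes>\<^bsub>?R\<^esub> Z = X \<otimes>\<^bsub>?R\<^esub> Z \<oplus>\<^bsub>?R\<^esub> Y \<otimes>\<^bsub>?R\<^esub> Z"
      unfolding X Y Z using f g h
      by (simp_all add: ops add.assoc mult.assoc distrib_right)
  qed (simp_all add: zero one cI)
qed

lemma equiv_MA_rel: "equiv (sets M) (MA_rel M)"
proof (intro equivI refl_onI symI transI)
  show "(B, A) \<in> MA_rel M" if "(A, B) \<in> MA_rel M" for A B
    using that by (simp add: MA_rel_def eq_commute)
  show "(A, C) \<in> MA_rel M" if "(A, B) \<in> MA_rel M" "(B, C) \<in> MA_rel M" for A B C
  proof -
    have "AE \<omega> in M. \<omega> \<in> A \<longleftrightarrow> \<omega> \<in> B" "AE \<omega> in M. \<omega> \<in> B \<longleftrightarrow> \<omega> \<in> C"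
      using that by (simp_all add: MA_rel_def)
    then have "AE \<omega> in M. \<omega> \<in> A \<longleftrightarrow> \<omega> \<in> C" by eventually_elim simp
    then show ?thesis using that by (simp add: MA_rel_def)
  qed
qed (simp_all add: MA_rel_def subset_iff)

lemma MA_rep: 
  assumes "a \<in> measure_algebra M"
  shows "rep a \<in> sets M" "MA_class M (rep a) = a"
proof -
  obtain A where A: "A \<in> sets M" "a = MA_class M A"
    using assms unfolding measure_algebra_def MA_class_def by (rule quotientE)
  have "A \<in> a" unfolding A(2) using A(1) by (simp add: MA_class_def MA_rel_def)
  then have "rep a \<in> a" unfolding rep_def some_in_eq by blast
  then have r: "(A, rep a) \<in> MA_rel M" using A(2) by (simp add: MA_class_def)
  then show "rep a \<in> sets M" by (simp add: MA_rel_def)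
  show "MA_class M (rep a) = a"
    using equiv_class_eq[OF equiv_MA_rel r] A(2) by (simp add: MA_class_def)
qed

context rn_module
begin

lemma rnorm_rep_measurable: "x \<in> carrier E \<Longrightarrow> rep (rnorm E x) \<in> borel_measurable M"
  using rnorm_nonneg[of x] by (auto simp: L0_nonneg_def intro: L0_rep)

lemma el_nhd_mono:
  assumes "x \<in> carrier E" "\<epsilon> \<le> \<epsilon>'" "\<delta> \<le> \<delta>'"
  shows "el_nhd M E x \<epsilon> \<delta> \<subseteq> el_nhd M E x \<epsilon>' \<delta>'"
proof
  fix y assume y: "y \<in> el_nhd M E x \<epsilon> \<delta>"
  let ?n = "rep (rnorm E (y \<ominus>\<^bsub>E\<^esub> x))"
  have [measurable]: "?n \<in> borel_measurable M"
    using y assms(1) by (intro rnorm_rep_measurable) (auto simp: el_nhd_def)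
  have "measure M {\<omega> \<in> space M. ?n \<omega> < \<epsilon>} \<le> measure M {\<omega> \<in> space M. ?n \<omega> < \<epsilon>'}"
    using assms(2) by (intro finite_measure_mono) auto
  then show "y \<in> el_nhd M E x \<epsilon>' \<delta>'" using y assms(3) by (auto simp: el_nhd_def)
qed

lemma istopology_el:
  "istopology (\<lambda>U. U \<subseteq> carrier E \<and>
     (\<forall>x\<in>U. \<exists>\<epsilon>>0. \<exists>\<delta>. 0 < \<delta> \<and> \<delta> < 1 \<and> el_nhd M E x \<epsilon> \<delta> \<subseteq> U))" (is "istopology ?P")
  unfolding istopology_def
proof (intro conjI allI impI)
  fix S T assume S: "?P S" and T: "?P T"
  show "S \<inter> T \<subseteq> carrier E" using S by blast
  show "\<forall>x\<in>S \<inter> T. \<exists>\<epsilon>>0. \<exists>\<delta>. 0 < \<delta> \<and> \<delta> < 1 \<and> el_nhd M E x \<epsilon> \<delta> \<subseteq> S \<inter> T"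
  proof
    fix x assume x: "x \<in> S \<inter> T"
    obtain e l where 1: "0 < e" "0 < l" "l < 1" "el_nhd M E x e l \<subseteq> S" using S x by blast
    obtain e' l' where 2: "0 < e'" "0 < l'" "l' < 1" "el_nhd M E x e' l' \<subseteq> T" using T x by blast
    have "x \<in> carrier E" using x S by blast
    then have "el_nhd M E x (min e e') (min l l') \<subseteq> S \<inter> T"
      using 1(4) 2(4) el_nhd_mono[of x "min e e'" e "min l l'" l]
        el_nhd_mono[of x "min e e'" e' "min l l'" l'] by fastforce
    then show "\<exists>\<epsilon>>0. \<exists>\<delta>. 0 < \<delta> \<and> \<delta> < 1 \<and> el_nhd M E x \<epsilon> \<delta> \<subseteq> S \<inter> T"
      using 1 2 by (intro exI[of _ "min e e'"] conjI exI[of _ "min l l'"]) auto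
  qed
next
  fix K assume K: "\<forall>S\<in>K. ?P S"
  show "\<Union> K \<subseteq> carrier E" using K by blast
  show "\<forall>x\<in>\<Union> K. \<exists>\<epsilon>>0. \<exists>\<delta>. 0 < \<delta> \<and> \<delta> < 1 \<and> el_nhd M E x \<epsilon> \<delta> \<subseteq> \<Union> K"
  proof
    fix x assume "x \<in> \<Union> K"
    then obtain S where S: "S \<in> K" "x \<in> S" by blast
    then obtain e l where "0 < e" "0 < l" "l < 1" "el_nhd M E x e l \<subseteq> S" using K by blast
    moreover have "S \<subseteq> \<Union> K" using S by blast
    ultimately show "\<exists>\<epsilon>>0. \<exists>\<delta>. 0 < \<delta> \<and> \<delta> < 1 \<and> el_nhd M E x \<epsilon> \<delta> \<subseteq> \<Union> K"
      by (intro exI[of _ e] conjI exI[of _ l]) auto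
  qed
qed

lemma openin_el_topology:
  "openin (el_topology M E) U \<longleftrightarrow> U \<subseteq> carrier E \<and>
     (\<forall>x\<in>U. \<exists>\<epsilon>>0. \<exists>\<delta>. 0 < \<delta> \<and> \<delta> < 1 \<and> el_nhd M E x \<epsilon> \<delta> \<subseteq> U)"
  unfolding el_topology_def using istopology_el by (simp add: topology_inverse')

lemma glue_unique:
  assumes a: "partition_of_unity M a" and z: "z \<in> carrier E" "z' \<in> carrier E"
    and eq: "\<And>n. L0_ind M (a n) \<odot>\<^bsub>E\<^esub> z = L0_ind M (a n) \<odot>\<^bsub>E\<^esub> z'"
  shows "z = z'"
proof -
  let ?I = "\<lambda>n. L0_ind M (a n) :: ('a \<Rightarrow> 'k) set"
  define d where "d = z \<ominus>\<^bsub>E\<^esub> z'"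
  have d: "d \<in> carrier E" using z by (simp add: d_def)
  have meas: "rep (a n) \<in> sets M" for n
    using a by (auto simp: partition_of_unity_def intro: MA_rep)
  have ind: "(indicator (rep (a n)) :: 'a \<Rightarrow> 'k) \<in> borel_measurable M" for n using meas by simp
  have I: "?I n \<in> carrier (L0_ring M)" for n
    unfolding L0_ind_def by (simp add: L0_ring_def L0_classI ind)
  have Id: "?I n \<odot>\<^bsub>E\<^esub> d = \<zero>\<^bsub>E\<^esub>" for n
  proof -
    have "?I n \<odot>\<^bsub>E\<^esub> d = ?I n \<odot>\<^bsub>E\<^esub> z \<ominus>\<^bsub>E\<^esub> ?I n \<odot>\<^bsub>E\<^esub> z'"
      using I z by (simp add: d_def M.minus_eq smult_r_distr smult_r_minus)
    also have "\<dots> = \<zero>\<^bsub>E\<^esub>" using eq[of n] I[of n] z by (simp add: M.minus_eq M.r_neg)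
    finally show ?thesis .
  qed
  have cl: "rep (rnorm E d) \<in> borel_measurable M" using d by (rule rnorm_rep_measurable)
  have zc: "\<zero>\<^bsub>L0_ring M\<^esub> = L0_class M borel (\<lambda>_. 0 :: 'c::{real_normed_field, second_countable_topology})"
    by (simp add: L0_ring_def)
  have n0: "rnorm E \<zero>\<^bsub>E\<^esub> = \<zero>\<^bsub>L0_ring M\<^esub>"
  proof -
    have z0: "(\<zero>\<^bsub>L0_ring M\<^esub> :: ('a \<Rightarrow> 'k) set) \<in> L0 M borel" by (simp add: zc L0_classI)
    have "rnorm E \<zero>\<^bsub>E\<^esub> = rnorm E (\<zero>\<^bsub>L0_ring M\<^esub> \<odot>\<^bsub>E\<^esub> \<zero>\<^bsub>E\<^esub>)" by simp
    also have "\<dots> = L0_map M norm (\<zero>\<^bsub>L0_ring M\<^esub> :: ('a \<Rightarrow> 'k) set) \<otimes>\<^bsub>L0_ring M\<^esub> rnorm E \<zero>\<^bsub>E\<^esub>"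
      using z0 by (rule rnorm_smult) simp
    also have "L0_map M norm (\<zero>\<^bsub>L0_ring M\<^esub> :: ('a \<Rightarrow> 'k) set) = (\<zero>\<^bsub>L0_ring M\<^esub> :: ('a \<Rightarrow> real) set)"
    proof -
      have 1: "(\<lambda>_. 0 :: 'k) \<in> borel_measurable M" by simp
      note [measurable] = rep_class(1)[OF 1]
      have "AE \<omega> in M. norm (rep (L0_class M borel (\<lambda>_. 0 :: 'k)) \<omega>) = 0"
        using rep_class(2)[OF 1] by eventually_elim simp
      then show ?thesis unfolding L0_map_def zc by (subst L0_class_eq_iff) auto
    qed
    finally show ?thesis
      using cring.cring_simprules(26)[OF cring_L0_ring, of "rnorm E \<zero>\<^bsub>E\<^esub>" M] rnorm_nonneg[of "\<zero>\<^bsub>E\<^esub>"]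
      by (simp add: L0_nonneg_def L0_ring_def)
  qed
  have AEn: "AE \<omega> in M. \<omega> \<in> rep (a n) \<longrightarrow> rep (rnorm E d) \<omega> = 0" for n
  proof -
    have "L0_map M norm (?I n) \<otimes>\<^bsub>L0_ring M\<^esub> rnorm E d = \<zero>\<^bsub>L0_ring M\<^esub>"
      using rnorm_smult[of "?I n" d] I[of n] d Id[of n] n0 by (simp add: L0_ring_def)
    moreover note rI = rep_class[OF ind[of n], folded L0_ind_def]
    have [measurable]: "rep (?I n) \<in> borel_measurable M" by (rule rI)
    have m1: "(\<lambda>\<omega>. norm (rep (?I n) \<omega>)) \<in> borel_measurable M" by simp
    note rN = rep_class[OF m1, folded L0_map_def]
    note [measurable] = rN(1) cl
    ultimately have "AE \<omega> in M. rep (L0_map M norm (?I n)) \<omega> * rep (rnorm E d) \<omega> = 0"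
      by (simp add: L0_ring_def L0_map2_def L0_class_eq_iff)
    then show ?thesis using rN(2) rI(2) by eventually_elim (auto simp: indicator_def)
  qed
  have "AE \<omega> in M. \<omega> \<in> (\<Union>n. rep (a n)) \<longleftrightarrow> \<omega> \<in> space M"
  proof -
    have "(\<Union>n. rep (a n), space M) \<in> MA_rel M"
      using a meas eq_equiv_class_iff[OF equiv_MA_rel, of "\<Union>n. rep (a n)" M "space M"]
      by (auto simp: partition_of_unity_def MA_class_def)
    then show ?thesis by (simp add: MA_rel_def)
  qed
  moreover have "AE \<omega> in M. \<forall>n. \<omega> \<in> rep (a n) \<longrightarrow> rep (rnorm E d) \<omega> = 0"
    unfolding AE_all_countable using AEn by blast
  moreover have "AE \<omega> in M. \<omega> \<in> space M" by simp
  ultimately have "AE \<omega> in M. rep (rnorm E d) \<omega> = 0" by eventually_elim auto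
  then have "L0_class M borel (rep (rnorm E d)) = L0_class M borel (\<lambda>_. 0)"
    using cl by (simp add: L0_class_eq_iff)
  then have "rnorm E d = \<zero>\<^bsub>L0_ring M\<^esub>"
    using rnorm_nonneg[OF d] L0_rep(2)[of "rnorm E d" M borel] by (simp add: zc L0_nonneg_def)
  then have "d = \<zero>\<^bsub>E\<^esub>" using d by (intro rnorm_eq_zero)
  then have "z \<oplus>\<^bsub>E\<^esub> \<ominus>\<^bsub>E\<^esub> z' = \<zero>\<^bsub>E\<^esub>" by (simp add: d_def M.minus_eq)
  then have "\<ominus>\<^bsub>E\<^esub> (\<ominus>\<^bsub>E\<^esub> z') = z" using z by (intro M.minus_equality) simp_all
  then show ?thesis using z by simp
qed

end

end

theory Submission
  imports Defs
begin

text \<open>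
  Fix a selection \<open>f\<close> of \<open>F\<close> and a countable set \<open>{x\<^sub>n}\<close> in \<open>G\<close> that contains every rational convex
  combination of the points \<open>y\<^sub>n = f x\<^sub>n\<close>.  For almost every \<open>\<omega>\<close> this set is totally bounded in the
  pseudometric \<open>\<parallel>x - y\<parallel>(\<omega>)\<close>: otherwise a random sequence of separated points would have no convergent
  random subsequence.  Kuhn's lemma, applied for such an \<open>\<omega>\<close> to a finite net, gives rational weights
  \<open>\<lambda>\<^sub>i\<close> such that the combination of the \<open>y\<^sub>i\<close> is close at \<open>\<omega>\<close> to every \<open>x\<^sub>i\<close> with \<open>\<lambda>\<^sub>i > 0\<close>.  There are only
  countably many weight vectors, so they can be chosen measurably and glued; a cluster point \<open>z\<close> of
  the resulting random approximate fixed points satisfies \<open>z \<in> F z\<close>.  For this, upper semicontinuity is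
  tested on elements equal to \<open>x\<^sub>i\<close> where \<open>x\<^sub>i\<close> is near \<open>z\<close>, and equal to \<open>z\<close> elsewhere.
\<close>

section \<open>A combinatorial covering lemma\<close>

text \<open>Each difference is split as \<open>(r j - q j) / R - q j * (1 / Q - 1 / R)\<close>, with
  \<open>Q\<close> and \<open>R\<close> the two weight sums. Both parts are nonnegative and each
  sums to \<open>(R - Q) / R\<close>, where \<open>R - Q\<close> is at most
  \<open>k\<close>.\<close>

lemma normalized_weights_variation:
  fixes q r :: "nat \<Rightarrow> nat"
  assumes cell: "\<And>j. j < k \<Longrightarrow> q j \<le> r j \<and> r j \<le> q j + 1" and pos: "sum q {..<k} > 0"
  shows "(\<Sum>j<k. \<bar>real (r j) / real (sum r {..<k}) - real (q j) / real (sum q {..<k})\<bar>)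
    \<le> 2 * real k / real (sum q {..<k})"
proof -
  let ?R = "real (sum r {..<k})" and ?Q = "real (sum q {..<k})"
  have QR: "?Q \<le> ?R" using cell by (auto intro!: sum_mono)
  have "sum r {..<k} \<le> (\<Sum>j<k. q j + 1)" using cell by (intro sum_mono) auto
  also have "\<dots> = sum q {..<k} + k" by (simp only: sum.distrib) simp
  finally have RQ: "?R - ?Q \<le> real k" by linarith
  have Q0: "?Q > 0" using pos by (simp only: of_nat_0_less_iff)
  have "(\<Sum>j<k. \<bar>real (r j) / ?R - real (q j) / ?Q\<bar>)
      \<le> (\<Sum>j<k. (real (r j) - real (q j)) / ?R + real (q j) * (1 / ?Q - 1 / ?R))"
  proof (rule sum_mono)
    fix j assume "j \<in> {..<k}"
    then have 1: "0 \<le> (real (r j) - real (q j)) / ?R" using cell[of j] Q0 QR by auto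
    have "1 / ?R \<le> 1 / ?Q" using Q0 QR by (intro divide_left_mono) auto
    then have 2: "0 \<le> real (q j) * (1 / ?Q - 1 / ?R)" by simp
    have "real (r j) / ?R - real (q j) / ?Q =
        (real (r j) - real (q j)) / ?R - real (q j) * (1 / ?Q - 1 / ?R)"
      by (simp add: algebra_simps diff_divide_distrib)
    then show "\<bar>real (r j) / ?R - real (q j) / ?Q\<bar>
        \<le> (real (r j) - real (q j)) / ?R + real (q j) * (1 / ?Q - 1 / ?R)"
      using 1 2 by linarith
  qed
  also have "\<dots> = (?R - ?Q) / ?R + ?Q * (1 / ?Q - 1 / ?R)"
    by (simp only: sum.distrib sum_distrib_right[symmetric] sum_divide_distrib[symmetric] sum_subtractf of_nat_sum)
  also have "\<dots> = 2 * (?R - ?Q) / ?R" using Q0 QR by (simp add: field_simps)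
  also have "\<dots> \<le> 2 * real k / ?Q" using Q0 QR RQ by (intro frac_le) auto
  finally show ?thesis .
qed

text \<open>In the application \<open>\<rho> r i\<close> is the distance from the average with
  weights \<open>r\<close> to the \<open>i\<close>-th net point, and \<open>osc\<close> is its
  Lipschitz dependence on the normalized weights. Kuhn's lemma yields a cell on whose corners every
  coordinate takes both labels. Label \<open>1\<close> in the coordinate of a nearby net point
  forces a large weight sum; after that, label \<open>0\<close> in a positive coordinate can only
  mean closeness.\<close>

lemma kuhn_weights:
  fixes \<rho> :: "(nat \<Rightarrow> nat) \<Rightarrow> nat \<Rightarrow> real"
  assumes k: "k > 0" and e: "e > 0" and C: "C \<ge> 0"
    and osc: "\<And>r q i. i < k \<Longrightarrow> sum r {..<k} > 0 \<Longrightarrow> sum q {..<k} > 0 \<Longrightarrow>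
      \<bar>\<rho> r i - \<rho> q i\<bar> \<le> C * (\<Sum>j<k. \<bar>real (r j) / real (sum r {..<k}) - real (q j) / real (sum q {..<k})\<bar>)"
    and net: "\<And>r. sum r {..<k} > 0 \<Longrightarrow> \<exists>i<k. \<rho> r i < e / 2"
  shows "\<exists>q. sum q {..<k} > 0 \<and> (\<forall>i<k. q i > 0 \<longrightarrow> \<rho> q i < 2 * e)"
proof -
  \<comment> \<open>For weight sums of at least \<open>N\<close>,
    \<open>normalized_weights_variation\<close> bounds the oscillation of \<open>\<rho>\<close> over
    a cell by \<open>2 * C * k / N < e / 2\<close>.\<close>
  obtain N :: nat where N: "real N > 4 * C * real k / e" "N > 0"
  proof -
    obtain N :: nat where "real N > max 0 (4 * C * real k / e)" using reals_Archimedean2 by blast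
    then show ?thesis using that[of N] by auto
  qed
  \<comment> \<open>Since \<open>p - 1\<close> is at least \<open>k + N\<close>, a cell that touches
    the top face in one coordinate has a weight sum past the threshold used in
    \<open>lab\<close>.\<close>
  define p where "p = 2 * (k + N)"
  \<comment> \<open>Coordinate \<open>i\<close> is pushed up while the point is near \<open>i\<close>.  Forcing the label \<open>0\<close> for small weight
    sums keeps the cell found below away from the origin, where normalization is discontinuous.\<close>
  define lab where "lab = (\<lambda>r i. if r i = 0 \<or> (r i < p \<and> (sum r {..<k} < k + N \<or> \<rho> r i < e)) then 0 else 1::nat)"
  have p: "p > 0" using k by (simp add: p_def)
  obtain q where q: "\<forall>i<k. q i < p"
    and cell: "\<forall>i<k. \<exists>r s. (\<forall>j<k. q j \<le> r j \<and> r j \<le> q j + 1) \<and> (\<forall>j<k. q j \<le> s j \<and> s j \<le> q j + 1)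
      \<and> lab r i \<noteq> lab s i"
    by (rule kuhn_lemma[of p k lab]) (use p in \<open>auto simp: lab_def\<close>)
  have cell01: "\<exists>r. (\<forall>j<k. q j \<le> r j \<and> r j \<le> q j + 1) \<and> lab r i = 0"
    "\<exists>r. (\<forall>j<k. q j \<le> r j \<and> r j \<le> q j + 1) \<and> lab r i = 1" if i: "i < k" for i
  proof -
    have "lab r i = 0 \<or> lab r i = 1" for r by (simp add: lab_def)
    then show "\<exists>r. (\<forall>j<k. q j \<le> r j \<and> r j \<le> q j + 1) \<and> lab r i = 0"
      "\<exists>r. (\<forall>j<k. q j \<le> r j \<and> r j \<le> q j + 1) \<and> lab r i = 1"
      using cell i by metis+
  qed
  have up: "sum q {..<k} \<le> sum r {..<k}" "sum r {..<k} \<le> sum q {..<k} + k"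
    if "\<forall>j<k. q j \<le> r j \<and> r j \<le> q j + 1" for r
  proof -
    show "sum q {..<k} \<le> sum r {..<k}" using that by (intro sum_mono) auto
    have "sum r {..<k} \<le> (\<Sum>j<k. q j + 1)" using that by (intro sum_mono) auto
    also have "\<dots> = sum q {..<k} + k" by (simp only: sum.distrib) simp
    finally show "sum r {..<k} \<le> sum q {..<k} + k" .
  qed
  have le_sum: "r i \<le> sum r {..<k}" if "i < k" for r :: "nat \<Rightarrow> nat" and i
    using that by (intro member_le_sum) auto
  have QN: "sum q {..<k} \<ge> N"
  proof (rule ccontr)
    assume *: "\<not> sum q {..<k} \<ge> N"
    obtain r where r: "\<forall>j<k. q j \<le> r j \<and> r j \<le> q j + 1" and l: "lab r 0 = 1" using cell01(2)[OF k] by blast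
    have "sum r {..<k} < k + N" using * up(2)[OF r] by linarith
    moreover have "r 0 \<le> sum r {..<k}" using k by (rule le_sum)
    ultimately show False using l by (simp add: lab_def p_def split: if_splits)
  qed
  then have Q0: "sum q {..<k} > 0" using N(2) by linarith
  have close: "\<bar>\<rho> r i - \<rho> q i\<bar> < e / 2" if r: "\<forall>j<k. q j \<le> r j \<and> r j \<le> q j + 1" and i: "i < k" for r i
  proof -
    have "\<bar>\<rho> r i - \<rho> q i\<bar> \<le> C * (\<Sum>j<k. \<bar>real (r j) / real (sum r {..<k}) - real (q j) / real (sum q {..<k})\<bar>)"
      using i Q0 up(1)[OF r] by (intro osc) auto
    also have "\<dots> \<le> C * (2 * real k / real (sum q {..<k}))"
      using normalized_weights_variation[of k q r] r Q0 C by (intro mult_left_mono) auto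
    also have "\<dots> \<le> C * (2 * real k / real N)"
      using C QN N(2) by (intro mult_left_mono divide_left_mono) (auto simp flip: of_nat_sum)
    also have "\<dots> < e / 2" using N e by (simp add: field_simps)
    finally show ?thesis .
  qed
  \<comment> \<open>Net point \<open>i0\<close> is close at \<open>q\<close>, hence at every corner
    of the cell, so its label \<open>1\<close> can only come from a coordinate that has reached
    \<open>p\<close>.\<close>
  obtain i0 where i0: "i0 < k" "\<rho> q i0 < e / 2" using net[OF Q0] by blast
  obtain r0 where r0: "\<forall>j<k. q j \<le> r0 j \<and> r0 j \<le> q j + 1" "lab r0 i0 = 1" using cell01(2)[OF i0(1)] by blast
  have "\<rho> r0 i0 < e" using close[OF r0(1) i0(1)] i0(2) by linarith
  then have "r0 i0 \<ge> p" using r0(2) by (simp add: lab_def split: if_splits)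
  then have "q i0 + 1 \<ge> p" using r0(1) i0(1) by (meson le_trans)
  then have big: "sum q {..<k} \<ge> k + N" using le_sum[OF i0(1), of q] k by (simp add: p_def)
  have "\<rho> q i < 2 * e" if i: "i < k" and qi: "q i > 0" for i
  proof -
    obtain r where r: "\<forall>j<k. q j \<le> r j \<and> r j \<le> q j + 1" "lab r i = 0" using cell01(1)[OF i] by blast
    have "r i > 0" using r(1) i qi by (metis less_le_trans)
    then have "\<rho> r i < e" using r(2) up(1)[OF r(1)] big by (simp add: lab_def split: if_splits)
    then show ?thesis using close[OF r(1) i] e by linarith
  qed
  then show ?thesis using Q0 by blast
qed

section \<open>Random norms and scalar multiplication\<close>

lemma L0_ring_simps:
  "carrier (L0_ring M) = L0 M borel"
  "\<zero>\<^bsub>L0_ring M\<^esub> = L0_class M borel (\<lambda>_. 0)"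
  "\<one>\<^bsub>L0_ring M\<^esub> = L0_class M borel (\<lambda>_. 1)"
  by (simp_all add: L0_ring_def)

lemma L0_class_add:
  fixes f g :: "'a \<Rightarrow> 'k::{real_normed_field, second_countable_topology}"
  assumes [measurable]: "f \<in> borel_measurable M" "g \<in> borel_measurable M"
  shows "L0_class M borel f \<oplus>\<^bsub>L0_ring M\<^esub> L0_class M borel g = L0_class M borel (\<lambda>\<omega>. f \<omega> + g \<omega>)"
proof -
  note [measurable] = rep_class(1)[OF assms(1)] rep_class(1)[OF assms(2)]
  have "AE \<omega> in M. rep (L0_class M borel f) \<omega> + rep (L0_class M borel g) \<omega> = f \<omega> + g \<omega>"
    using rep_class(2)[OF assms(1)] rep_class(2)[OF assms(2)] by eventually_elim simp
  then show ?thesis by (simp add: L0_ring_def L0_map2_def L0_class_eq_iff)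
qed

lemma L0_class_mult:
  fixes f g :: "'a \<Rightarrow> 'k::{real_normed_field, second_countable_topology}"
  assumes [measurable]: "f \<in> borel_measurable M" "g \<in> borel_measurable M"
  shows "L0_class M borel f \<otimes>\<^bsub>L0_ring M\<^esub> L0_class M borel g = L0_class M borel (\<lambda>\<omega>. f \<omega> * g \<omega>)"
proof -
  note [measurable] = rep_class(1)[OF assms(1)] rep_class(1)[OF assms(2)]
  have "AE \<omega> in M. rep (L0_class M borel f) \<omega> * rep (L0_class M borel g) \<omega> = f \<omega> * g \<omega>"
    using rep_class(2)[OF assms(1)] rep_class(2)[OF assms(2)] by eventually_elim simp
  then show ?thesis by (simp add: L0_ring_def L0_map2_def L0_class_eq_iff)
qed

lemma L0_class_uminus:
  fixes f :: "'a \<Rightarrow> 'k::{real_normed_field, second_countable_topology}"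
  assumes f: "f \<in> borel_measurable M"
  shows "\<ominus>\<^bsub>L0_ring M\<^esub> L0_class M borel f = L0_class M borel (\<lambda>\<omega>. - f \<omega>)"
proof -
  interpret R: cring "L0_ring M :: ('a \<Rightarrow> 'k) set ring" by (rule cring_L0_ring)
  show ?thesis
    using f by (intro R.minus_equality) (simp_all add: L0_class_add L0_ring_simps L0_classI)
qed

lemma L0_class_minus:
  fixes f g :: "'a \<Rightarrow> 'k::{real_normed_field, second_countable_topology}"
  assumes "f \<in> borel_measurable M" "g \<in> borel_measurable M"
  shows "L0_class M borel f \<ominus>\<^bsub>L0_ring M\<^esub> L0_class M borel g = L0_class M borel (\<lambda>\<omega>. f \<omega> - g \<omega>)"
  using assms by (simp add: a_minus_def L0_class_uminus L0_class_add)

lemma L0_map_class: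
  fixes h :: "'b::{second_countable_topology, t2_space} \<Rightarrow> 'c::{second_countable_topology, t2_space}"
  assumes [measurable]: "f \<in> borel_measurable M" "h \<in> borel_measurable borel"
  shows "L0_map M h (L0_class M borel f) = L0_class M borel (\<lambda>\<omega>. h (f \<omega>))"
proof -
  note [measurable] = rep_class(1)[OF assms(1)]
  have "AE \<omega> in M. h (rep (L0_class M borel f) \<omega>) = h (f \<omega>)"
    using rep_class(2)[OF assms(1)] by eventually_elim simp
  then show ?thesis by (simp add: L0_map_def L0_class_eq_iff)
qed

text \<open>Fixing one representative turns the axioms of the random norm into almost sure
  statements about real functions. Countably many of them hold together outside one null set, so
  deterministic arguments can be run at a single outcome.\<close>

definition nrm :: "('a, 'k, 'e, 'z) rn_module_scheme \<Rightarrow> 'e \<Rightarrow> 'a \<Rightarrow> real" where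
  "nrm E x = rep (rnorm E x)"

text \<open>For almost every outcome this is a pseudometric on a given countable set of elements;
  the exceptional null set depends on that set.\<close>

definition dst :: "('a, 'k, 'e, 'z) rn_module_scheme \<Rightarrow> 'e \<Rightarrow> 'e \<Rightarrow> 'a \<Rightarrow> real" where
  "dst E x y = nrm E (x \<ominus>\<^bsub>E\<^esub> y)"

definition const_smult :: "'a measure \<Rightarrow>
    ('a, 'k::{real_normed_field, second_countable_topology}, 'e, 'z) rn_module_scheme \<Rightarrow> real \<Rightarrow> 'e \<Rightarrow> 'e"
  where "const_smult M E t x = L0_class M borel (\<lambda>_. of_real t) \<odot>\<^bsub>E\<^esub> x"

context rn_module
begin

lemma nrm_measurable [measurable]: "x \<in> carrier E \<Longrightarrow> nrm E x \<in> borel_measurable M"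
  unfolding nrm_def by (rule rnorm_rep_measurable)

lemma rnorm_class: "x \<in> carrier E \<Longrightarrow> rnorm E x = L0_class M borel (nrm E x)"
  using rnorm_nonneg[of x] L0_rep(2)[of "rnorm E x" M borel] by (simp add: nrm_def L0_nonneg_def)

lemma nrm_AE_eqI:
  assumes "x \<in> carrier E" "rnorm E x = L0_class M borel f" "f \<in> borel_measurable M"
  shows "AE \<omega> in M. nrm E x \<omega> = f \<omega>"
  using assms rep_class(2)[of f M borel] by (simp add: nrm_def)

lemma L0_class_carrier [simp, intro]:
  "f \<in> borel_measurable M \<Longrightarrow> L0_class M borel f \<in> carrier (L0_ring M)"
  by (simp add: L0_ring_simps L0_classI)

lemma AE_nrm_nonneg:
  assumes x: "x \<in> carrier E"
  shows "AE \<omega> in M. 0 \<le> nrm E x \<omega>"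
proof -
  have "AE \<omega> in M. rep (L0_class M borel (\<lambda>_. 0::real)) \<omega> \<le> nrm E x \<omega>"
    using rnorm_nonneg[OF x] by (simp add: L0_nonneg_def L0_le_def L0_ring_simps nrm_def)
  moreover have "AE \<omega> in M. rep (L0_class M borel (\<lambda>_. 0::real)) \<omega> = 0" by (rule rep_class) simp
  ultimately show ?thesis by eventually_elim simp
qed

lemma AE_nrm_triangle:
  assumes x: "x \<in> carrier E" and y: "y \<in> carrier E"
  shows "AE \<omega> in M. nrm E (x \<oplus>\<^bsub>E\<^esub> y) \<omega> \<le> nrm E x \<omega> + nrm E y \<omega>"
proof -
  have [measurable]: "nrm E x \<in> borel_measurable M" "nrm E y \<in> borel_measurable M" using x y by simp_all
  have "AE \<omega> in M. nrm E (x \<oplus>\<^bsub>E\<^esub> y) \<omega> \<le> rep (rnorm E x \<oplus>\<^bsub>L0_ring M\<^esub> rnorm E y) \<omega>"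
    using rnorm_triangle[OF x y] by (simp add: L0_le_def nrm_def)
  moreover have "AE \<omega> in M. rep (rnorm E x \<oplus>\<^bsub>L0_ring M\<^esub> rnorm E y) \<omega> = nrm E x \<omega> + nrm E y \<omega>"
    unfolding rnorm_class[OF x] rnorm_class[OF y]
    by (subst L0_class_add) (simp_all add: rep_class x y)
  ultimately show ?thesis by eventually_elim simp
qed

lemma AE_nrm_smult:
  assumes [measurable]: "f \<in> borel_measurable M" and x: "x \<in> carrier E"
  shows "AE \<omega> in M. nrm E (L0_class M borel f \<odot>\<^bsub>E\<^esub> x) \<omega> = norm (f \<omega>) * nrm E x \<omega>"
proof -
  have [measurable]: "nrm E x \<in> borel_measurable M" using x by simp
  show ?thesis
  proof (rule nrm_AE_eqI)
    show "L0_class M borel f \<odot>\<^bsub>E\<^esub> x \<in> carrier E" using x by simp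
    show "rnorm E (L0_class M borel f \<odot>\<^bsub>E\<^esub> x) = L0_class M borel (\<lambda>\<omega>. norm (f \<omega>) * nrm E x \<omega>)"
      using x by (simp add: rnorm_smult L0_classI L0_map_class rnorm_class[OF x] L0_class_mult)
  qed simp
qed

lemma const_smult_closed [simp, intro]: "x \<in> carrier E \<Longrightarrow> const_smult M E t x \<in> carrier E"
  by (simp add: const_smult_def)

lemma AE_nrm_const_smult:
  assumes "x \<in> carrier E"
  shows "AE \<omega> in M. nrm E (const_smult M E t x) \<omega> = \<bar>t\<bar> * nrm E x \<omega>"
  using AE_nrm_smult[of "\<lambda>_. of_real t" x] assms by (simp add: const_smult_def)

lemma const_smult_1 [simp]: "x \<in> carrier E \<Longrightarrow> const_smult M E 1 x = x"
  using smult_one[of x] by (simp add: const_smult_def L0_ring_simps)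

lemma const_smult_0 [simp]: "x \<in> carrier E \<Longrightarrow> const_smult M E 0 x = \<zero>\<^bsub>E\<^esub>"
  using smult_l_null[of x] by (simp add: const_smult_def L0_ring_simps)

lemma const_smult_add: "x \<in> carrier E \<Longrightarrow>
    const_smult M E (s + t) x = const_smult M E s x \<oplus>\<^bsub>E\<^esub> const_smult M E t x"
  by (simp add: const_smult_def L0_class_add flip: smult_l_distr)

lemma const_smult_assoc: "x \<in> carrier E \<Longrightarrow>
    const_smult M E s (const_smult M E t x) = const_smult M E (s * t) x"
  by (simp add: const_smult_def L0_class_mult flip: smult_assoc1)

lemma const_smult_distr: "x \<in> carrier E \<Longrightarrow> y \<in> carrier E \<Longrightarrow>
    const_smult M E t (x \<oplus>\<^bsub>E\<^esub> y) = const_smult M E t x \<oplus>\<^bsub>E\<^esub> const_smult M E t y"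
  by (simp add: const_smult_def smult_r_distr)

lemma const_smult_uminus: "x \<in> carrier E \<Longrightarrow> const_smult M E (- t) x = \<ominus>\<^bsub>E\<^esub> const_smult M E t x"
  by (simp add: const_smult_def L0_class_uminus flip: smult_l_minus)

lemma const_smult_r_minus: "x \<in> carrier E \<Longrightarrow> y \<in> carrier E \<Longrightarrow>
    const_smult M E t (x \<ominus>\<^bsub>E\<^esub> y) = const_smult M E t x \<ominus>\<^bsub>E\<^esub> const_smult M E t y"
  by (simp add: const_smult_def smult_r_distr smult_r_minus M.minus_eq)

lemma const_smult_diff: "x \<in> carrier E \<Longrightarrow>
    const_smult M E (s - t) x = const_smult M E s x \<ominus>\<^bsub>E\<^esub> const_smult M E t x"
  using const_smult_add[of x s "- t"] by (simp add: const_smult_uminus M.minus_eq)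

section \<open>Almost sure pseudometric properties of the random distance\<close>

lemma dst_measurable [measurable]: "x \<in> carrier E \<Longrightarrow> y \<in> carrier E \<Longrightarrow> dst E x y \<in> borel_measurable M"
  unfolding dst_def by simp

lemma AE_dst_self:
  assumes "x \<in> carrier E"
  shows "AE \<omega> in M. dst E x x \<omega> = 0"
  using AE_nrm_const_smult[of x 0] assms by (simp add: dst_def M.minus_eq M.r_neg)

lemma AE_dst_commute:
  assumes x: "x \<in> carrier E" and y: "y \<in> carrier E"
  shows "AE \<omega> in M. dst E x y \<omega> = dst E y x \<omega>"
proof -
  have "\<ominus>\<^bsub>E\<^esub> (y \<ominus>\<^bsub>E\<^esub> x) = x \<ominus>\<^bsub>E\<^esub> y"
    using x y by (simp add: M.minus_eq M.minus_add M.a_comm)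
  then have "const_smult M E (- 1) (y \<ominus>\<^bsub>E\<^esub> x) = x \<ominus>\<^bsub>E\<^esub> y"
    using x y const_smult_uminus[of "y \<ominus>\<^bsub>E\<^esub> x" 1] by simp
  then show ?thesis using AE_nrm_const_smult[of "y \<ominus>\<^bsub>E\<^esub> x" "- 1"] x y by (simp add: dst_def)
qed

lemma AE_dst_triangle:
  assumes x: "x \<in> carrier E" and y: "y \<in> carrier E" and z: "z \<in> carrier E"
  shows "AE \<omega> in M. dst E x z \<omega> \<le> dst E x y \<omega> + dst E y z \<omega>"
proof -
  have "(x \<ominus>\<^bsub>E\<^esub> y) \<oplus>\<^bsub>E\<^esub> (y \<ominus>\<^bsub>E\<^esub> z) = x \<ominus>\<^bsub>E\<^esub> z"
    using x y z by (simp add: M.minus_eq M.a_assoc M.r_neg2 M.r_neg1)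
  then show ?thesis using AE_nrm_triangle[of "x \<ominus>\<^bsub>E\<^esub> y" "y \<ominus>\<^bsub>E\<^esub> z"] x y z by (simp add: dst_def)
qed

lemma eq_of_AE_dst_0:
  assumes x: "x \<in> carrier E" and y: "y \<in> carrier E" and "AE \<omega> in M. dst E x y \<omega> = 0"
  shows "x = y"
proof -
  have "rnorm E (x \<ominus>\<^bsub>E\<^esub> y) = \<zero>\<^bsub>L0_ring M\<^esub>"
    using assms rnorm_class[of "x \<ominus>\<^bsub>E\<^esub> y"] by (simp add: L0_ring_simps L0_class_eq_iff dst_def)
  then have "x \<ominus>\<^bsub>E\<^esub> y = \<zero>\<^bsub>E\<^esub>" using x y by (intro rnorm_eq_zero) auto
  then have "x \<oplus>\<^bsub>E\<^esub> \<ominus>\<^bsub>E\<^esub> y = \<zero>\<^bsub>E\<^esub>" by (simp add: M.minus_eq)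
  then have "\<ominus>\<^bsub>E\<^esub> (\<ominus>\<^bsub>E\<^esub> y) = x" using x y by (intro M.minus_equality) simp_all
  then show ?thesis using y by simp
qed

end

section \<open>Random selections and convex combinations\<close>

lemma MA_class_eq_iff:
  "A \<in> sets M \<Longrightarrow> B \<in> sets M \<Longrightarrow> MA_class M A = MA_class M B \<longleftrightarrow> (AE \<omega> in M. \<omega> \<in> A \<longleftrightarrow> \<omega> \<in> B)"
  unfolding MA_class_def by (simp add: eq_equiv_class_iff[OF equiv_MA_rel]) (simp add: MA_rel_def)

lemma MA_classI: "A \<in> sets M \<Longrightarrow> MA_class M A \<in> measure_algebra M"
  unfolding MA_class_def measure_algebra_def by (rule quotientI)

lemma rep_MA_class:
  assumes "A \<in> sets M"
  shows "rep (MA_class M A) \<in> sets M" "AE \<omega> in M. \<omega> \<in> rep (MA_class M A) \<longleftrightarrow> \<omega> \<in> A"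
  using MA_rep[OF MA_classI[OF assms]] assms by (simp_all add: MA_class_eq_iff)

definition level_events :: "'a measure \<Rightarrow> ('a \<Rightarrow> nat) \<Rightarrow> nat \<Rightarrow> 'a set set" where
  "level_events M N n = MA_class M {\<omega> \<in> space M. N \<omega> = n}"

text \<open>The element that looks like \<open>x (N \<omega>)\<close> at the outcome
  \<open>\<omega>\<close>. A measurable index function encodes the partition of unity into its level
  sets, so gluing reduces to choosing an index measurably.\<close>

definition select :: "'a measure \<Rightarrow>
    ('a, 'k::{real_normed_field, second_countable_topology}, 'e, 'z) rn_module_scheme \<Rightarrow>
    ('a \<Rightarrow> nat) \<Rightarrow> (nat \<Rightarrow> 'e) \<Rightarrow> 'e" where
  "select M E N x = glue M E (level_events M N) x"

lemma partition_of_unity_level_events: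
  assumes [measurable]: "N \<in> M \<rightarrow>\<^sub>M count_space UNIV"
  shows "partition_of_unity M (level_events M N)"
proof -
  have A [measurable]: "{\<omega> \<in> space M. N \<omega> = n} \<in> sets M" for n by simp
  note r = rep_MA_class[OF A, folded level_events_def]
  \<comment> \<open>The representatives of the classes are disjoint and cover the space only off a
    null set; one null set serves all \<open>n\<close>.\<close>
  have ae: "AE \<omega> in M. \<forall>n. \<omega> \<in> rep (level_events M N n) \<longleftrightarrow> N \<omega> = n"
    unfolding AE_all_countable
  proof
    fix n show "AE \<omega> in M. \<omega> \<in> rep (level_events M N n) \<longleftrightarrow> N \<omega> = n"
      using r(2)[of n] AE_space by eventually_elim simp
  qed
  show ?thesis
    unfolding partition_of_unity_def
  proof (intro conjI allI impI)
    show "level_events M N n \<in> measure_algebra M" for n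
      unfolding level_events_def by (rule MA_classI) simp
    show "MA_class M (rep (level_events M N i) \<inter> rep (level_events M N j)) = MA_class M {}"
      if "i \<noteq> j" for i j
      using r(1) ae by (subst MA_class_eq_iff) (auto elim!: eventually_mono simp: that)
    show "MA_class M (\<Union>n. rep (level_events M N n)) = MA_class M (space M)"
    proof (subst MA_class_eq_iff)
      show "AE \<omega> in M. \<omega> \<in> (\<Union>n. rep (level_events M N n)) \<longleftrightarrow> \<omega> \<in> space M"
        using ae AE_space by eventually_elim auto
    qed (use r(1) in auto)
  qed
qed

text \<open>The weights need not sum to \<open>1\<close>, so that the induction for convexity can
  normalize partial sums.\<close>

primrec comb :: "'a measure \<Rightarrow>
    ('a, 'k::{real_normed_field, second_countable_topology}, 'e, 'z) rn_module_scheme \<Rightarrow>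
    (nat \<Rightarrow> real) \<Rightarrow> (nat \<Rightarrow> 'e) \<Rightarrow> nat \<Rightarrow> 'e" where
  "comb M E c v 0 = \<zero>\<^bsub>E\<^esub>"
| "comb M E c v (Suc k) = comb M E c v k \<oplus>\<^bsub>E\<^esub> const_smult M E (c k) (v k)"

context rn_module
begin

text \<open>Locality of the random norm: multiplying a difference by \<open>I_A\<close> multiplies
  its norm by the indicator of \<open>A\<close>, up to a null set.\<close>

lemma AE_dst_cong_ind:
  assumes A: "A \<in> sets M" and z: "z \<in> carrier E" "v \<in> carrier E" and u: "u \<in> carrier E"
    and eq: "L0_ind M (MA_class M A) \<odot>\<^bsub>E\<^esub> z = L0_ind M (MA_class M A) \<odot>\<^bsub>E\<^esub> v"
  shows "AE \<omega> in M. \<omega> \<in> A \<longrightarrow> dst E z u \<omega> = dst E v u \<omega>"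
proof -
  let ?f = "indicator (rep (MA_class M A)) :: 'a \<Rightarrow> 'k"
  have f: "?f \<in> borel_measurable M" using rep_MA_class(1)[OF A] by simp
  let ?I = "L0_class M borel ?f"
  have "?I \<odot>\<^bsub>E\<^esub> (z \<ominus>\<^bsub>E\<^esub> u) = ?I \<odot>\<^bsub>E\<^esub> (v \<ominus>\<^bsub>E\<^esub> u)"
    using eq z u f by (simp add: M.minus_eq smult_r_distr L0_ind_def)
  then have "AE \<omega> in M. norm (?f \<omega>) * dst E z u \<omega> = norm (?f \<omega>) * dst E v u \<omega>"
    using AE_nrm_smult[OF f, of "z \<ominus>\<^bsub>E\<^esub> u"] AE_nrm_smult[OF f, of "v \<ominus>\<^bsub>E\<^esub> u"] z u
    by (auto simp: dst_def)
  then show ?thesis using rep_MA_class(2)[OF A] by eventually_elim auto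
qed

lemma sigma_stableD: "sigma_stable M E S \<Longrightarrow> x \<in> S \<Longrightarrow> x \<in> carrier E"
  by (auto simp: sigma_stable_def)

text \<open>\<open>glue\<close> is a definite description; \<open>\<sigma>\<close>-stability
  supplies existence and \<open>glue_unique\<close> uniqueness.\<close>

lemma select_props:
  assumes S: "sigma_stable M E S" and x: "\<And>n. x n \<in> S" and N: "N \<in> M \<rightarrow>\<^sub>M count_space UNIV"
  shows "select M E N x \<in> S"
    and "L0_ind M (level_events M N n) \<odot>\<^bsub>E\<^esub> select M E N x = L0_ind M (level_events M N n) \<odot>\<^bsub>E\<^esub> x n"
proof -
  note p = partition_of_unity_level_events[OF N]
  obtain z where z: "z \<in> S"
    "\<And>n. L0_ind M (level_events M N n) \<odot>\<^bsub>E\<^esub> z = L0_ind M (level_events M N n) \<odot>\<^bsub>E\<^esub> x n"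
    using S x p unfolding sigma_stable_def by meson
  have "select M E N x = z"
    unfolding select_def glue_def using glue_unique[OF p] z sigma_stableD[OF S z(1)]
    by (intro the_equality) auto
  then show "select M E N x \<in> S"
    "L0_ind M (level_events M N n) \<odot>\<^bsub>E\<^esub> select M E N x = L0_ind M (level_events M N n) \<odot>\<^bsub>E\<^esub> x n"
    using z by auto
qed

text \<open>Locality is applied on each of the countably many level sets of \<open>N\<close>. This
  is the form in which glued elements are evaluated at an outcome.\<close>

lemma AE_dst_select_left:
  assumes S: "sigma_stable M E S" and x: "\<And>n. x n \<in> S"
    and N [measurable]: "N \<in> M \<rightarrow>\<^sub>M count_space UNIV" and u: "u \<in> carrier E"
  shows "AE \<omega> in M. dst E (select M E N x) u \<omega> = dst E (x (N \<omega>)) u \<omega>"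
proof -
  note p = select_props[of S x N, OF S x N]
  have "AE \<omega> in M. \<forall>n. \<omega> \<in> {\<omega> \<in> space M. N \<omega> = n} \<longrightarrow> dst E (select M E N x) u \<omega> = dst E (x n) u \<omega>"
    unfolding AE_all_countable
    using p u x sigma_stableD[OF S] by (intro allI AE_dst_cong_ind) (auto simp: level_events_def)
  then show ?thesis using AE_space by eventually_elim auto
qed

text \<open>The one-sided version, applied first with the whole second selection as fixed point,
  leaves distances to the single \<open>x n\<close>. It is then applied again for all
  \<open>n\<close> at once, since the relevant \<open>n\<close> depends on the outcome.\<close>

lemma AE_dst_select:
  assumes S: "sigma_stable M E S" and x: "\<And>n. x n \<in> S" and N: "N \<in> M \<rightarrow>\<^sub>M count_space UNIV"
    and S': "sigma_stable M E S'" and x': "\<And>n. x' n \<in> S'" and N': "N' \<in> M \<rightarrow>\<^sub>M count_space UNIV"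
  shows "AE \<omega> in M. dst E (select M E N x) (select M E N' x') \<omega> = dst E (x (N \<omega>)) (x' (N' \<omega>)) \<omega>"
proof -
  have c: "x n \<in> carrier E" "x' n \<in> carrier E" "select M E N' x' \<in> carrier E" for n
    using x x' S S' select_props(1)[of S' x' N', OF S' x' N'] by (auto intro: sigma_stableD)
  have "AE \<omega> in M. \<forall>n. dst E (select M E N' x') (x n) \<omega> = dst E (x' (N' \<omega>)) (x n) \<omega>"
    unfolding AE_all_countable using c by (intro allI AE_dst_select_left[of S' x' N', OF S' x' N'])
  moreover have "AE \<omega> in M. \<forall>n. dst E (x n) (select M E N' x') \<omega> = dst E (select M E N' x') (x n) \<omega>"
    unfolding AE_all_countable using c by (intro allI AE_dst_commute)
  moreover have "AE \<omega> in M. \<forall>n m. dst E (x' m) (x n) \<omega> = dst E (x n) (x' m) \<omega>"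
    unfolding AE_all_countable using c by (intro allI AE_dst_commute)
  moreover note AE_dst_select_left[of S x N, OF S x N c(3)]
  ultimately show ?thesis by eventually_elim simp
qed

lemma select_eqI:
  assumes S: "sigma_stable M E S" and x: "\<And>n. x n \<in> S" and N: "N \<in> M \<rightarrow>\<^sub>M count_space UNIV"
    and u: "u \<in> carrier E" and eq: "AE \<omega> in M. dst E (x (N \<omega>)) u \<omega> = 0"
  shows "select M E N x = u"
proof (rule eq_of_AE_dst_0[OF sigma_stableD[OF S select_props(1)[of S x N, OF S x N]] u])
  show "AE \<omega> in M. dst E (select M E N x) u \<omega> = 0"
    using AE_dst_select_left[of S x N, OF S x N u] eq by eventually_elim simp
qed

lemma select_const:
  assumes S: "sigma_stable M E S" and x: "x \<in> S" and N: "N \<in> M \<rightarrow>\<^sub>M count_space UNIV"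
  shows "select M E N (\<lambda>_. x) = x"
  using AE_dst_self[of x] sigma_stableD[OF S x] x by (intro select_eqI[OF S _ N]) auto

lemma sigma_stable_map_select:
  assumes "sigma_stable_map M E E X F" and "\<And>n. x n \<in> X" and "N \<in> M \<rightarrow>\<^sub>M count_space UNIV"
  shows "F (select M E N x) = {select M E N v | v. \<forall>n. v n \<in> F (x n)}"
  using assms partition_of_unity_level_events[of N M]
  by (auto simp: sigma_stable_map_def set_glue_def select_def)

text \<open>Gluing the constant sequence \<open>x\<close> gives back \<open>x\<close>, so
  \<open>\<sigma>\<close>-stability of \<open>F\<close> says that gluing values from
  \<open>F x\<close> stays in \<open>F x\<close>.\<close>

lemma sigma_stable_value:
  assumes F: "sigma_stable_map M E E X F" and x: "x \<in> X"
    and v: "\<And>n. v n \<in> F x" and N: "N \<in> M \<rightarrow>\<^sub>M count_space UNIV"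
  shows "select M E N v \<in> F x"
proof -
  have X: "sigma_stable M E X" using F by (simp add: sigma_stable_map_def)
  show ?thesis
    using sigma_stable_map_select[OF F x N] select_const[OF X x N] v by auto
qed

lemma random_subseqE:
  assumes "random_subseq M E x y"
  obtains N where "\<And>k. N k \<in> M \<rightarrow>\<^sub>M count_space UNIV" "\<And>k. AE \<omega> in M. N k \<omega> < N (Suc k) \<omega>"
    "\<And>k. y k = select M E (N k) x"
proof -
  obtain n where n: "\<And>k. n k \<in> L0 M (count_space UNIV)" "\<And>k. L0_less M (n k) (n (Suc k))"
    "\<And>k. y k = glue M E (L0_eq_event M (n k)) x"
    using assms by (auto simp: random_subseq_def)
  have "L0_eq_event M (n k) = level_events M (rep (n k))" for k
    by (intro ext) (simp add: L0_eq_event_def level_events_def)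
  then show ?thesis using n L0_rep(1)[OF n(1)]
    by (intro that[of "\<lambda>k. rep (n k)"]) (auto simp: L0_less_def select_def)
qed

section \<open>Convex combinations with real weights\<close>

lemma comb_closed [simp, intro]: "(\<And>i. i < k \<Longrightarrow> v i \<in> carrier E) \<Longrightarrow> comb M E c v k \<in> carrier E"
  by (induction k) auto

lemma comb_scale:
  assumes "\<And>i. i < k \<Longrightarrow> v i \<in> carrier E"
  shows "comb M E (\<lambda>i. t * c i) v k = const_smult M E t (comb M E c v k)"
  using assms
proof (induction k)
  case 0
  then show ?case by (simp add: const_smult_def)
qed (simp add: const_smult_distr const_smult_assoc)

lemma L0_convex_const:
  assumes G: "L0_convex M E G" and x: "x \<in> G" and y: "y \<in> G" and t: "0 \<le> t" "t \<le> 1"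
  shows "const_smult M E t x \<oplus>\<^bsub>E\<^esub> const_smult M E (1 - t) y \<in> G"
proof -
  let ?t = "L0_class M borel (\<lambda>_. t)"
  note c = rep_class(2)[of "\<lambda>_. _ :: real" M borel, simplified]
  have "?t \<in> L0_nonneg M"
    using c[of 0] c[of t] t(1) by (auto simp: L0_nonneg_def L0_classI L0_le_def L0_ring_simps)
  moreover have "L0_le M ?t \<one>\<^bsub>L0_ring M\<^esub>"
    using c[of 1] c[of t] t(2) by (auto simp: L0_le_def L0_ring_simps)
  ultimately have "L0_map M of_real ?t \<odot>\<^bsub>E\<^esub> x \<oplus>\<^bsub>E\<^esub>
          (\<one>\<^bsub>L0_ring M\<^esub> \<ominus>\<^bsub>L0_ring M\<^esub> L0_map M of_real ?t) \<odot>\<^bsub>E\<^esub> y \<in> G"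
    using G x y unfolding L0_convex_def by blast
  moreover have "L0_map M of_real ?t = (L0_class M borel (\<lambda>_. of_real t) :: ('a \<Rightarrow> 'k) set)"
    by (rule L0_map_class) auto
  ultimately show ?thesis by (simp add: const_smult_def L0_ring_simps L0_class_minus)
qed

text \<open>The normalized combination of the first \<open>k\<close> points, with weight
  \<open>?u / s\<close>, is joined to the last point with the remaining weight
  \<open>c k / s\<close>. If \<open>?u = 0\<close>, only the last point is left.\<close>

lemma comb_in_convex:
  assumes G: "L0_convex M E G" and v: "\<And>i. i < k \<Longrightarrow> v i \<in> G"
    and c: "\<And>i. i < k \<Longrightarrow> c i \<ge> 0" "sum c {..<k} = s" "s > 0"
  shows "const_smult M E (1 / s) (comb M E c v k) \<in> G"
  using v c
proof (induction k arbitrary: s)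
  case (Suc k)
  have car: "v i \<in> carrier E" if "i \<le> k" for i
    using G Suc.prems(1)[of i] that by (auto simp: L0_convex_def)
  then have cc: "comb M E c v k \<in> carrier E" by auto
  let ?u = "sum c {..<k}"
  have s: "s = ?u + c k" using Suc.prems by simp
  have u0: "?u \<ge> 0" using Suc.prems(2) by (intro sum_nonneg) auto
  show ?case
  proof (cases "?u = 0")
    case True
    then have "\<forall>i<k. c i = 0" using Suc.prems(2) by (subst (asm) sum_nonneg_eq_0_iff) auto
    \<comment> \<open>All these weights vanish, so scaling them by \<open>0\<close> changes nothing,
      and \<open>comb_scale\<close> turns the combination into the null element.\<close>
    then have "comb M E (\<lambda>i. 0 * c i) v k = comb M E c v k"
      by (induction k) auto
    then have "comb M E c v k = \<zero>\<^bsub>E\<^esub>" using comb_scale[of k v 0 c] car cc by simp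
    then show ?thesis using s True Suc.prems car by (simp add: const_smult_assoc)
  next
    case False
    then have "const_smult M E (1 / ?u) (comb M E c v k) \<in> G"
      using Suc.prems u0 by (intro Suc.IH) auto
    moreover have "v k \<in> G" "0 \<le> c k" using Suc.prems by auto
    ultimately have "const_smult M E (?u / s) (const_smult M E (1 / ?u) (comb M E c v k)) \<oplus>\<^bsub>E\<^esub>
        const_smult M E (1 - ?u / s) (v k) \<in> G"
      using s u0 Suc.prems(4) by (intro L0_convex_const[OF G]) auto
    moreover have "1 - ?u / s = c k / s" using s Suc.prems(4) by (simp add: field_simps)
    ultimately show ?thesis
      using False car cc by (simp add: const_smult_assoc const_smult_distr)
  qed
qed simp

lemma AE_dst_comb:
  assumes v: "\<And>i. i < k \<Longrightarrow> v i \<in> carrier E" and w: "\<And>i. i < k \<Longrightarrow> w i \<in> carrier E"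
  shows "AE \<omega> in M. dst E (comb M E c v k) (comb M E d w k) \<omega>
    \<le> (\<Sum>i<k. dst E (const_smult M E (c i) (v i)) (const_smult M E (d i) (w i)) \<omega>)"
  using v w
proof (induction k)
  case 0
  then show ?case using AE_dst_self[of "\<zero>\<^bsub>E\<^esub>"] by auto
next
  case (Suc k)
  let ?a = "comb M E c v k" and ?b = "comb M E d w k"
  let ?x = "const_smult M E (c k) (v k)" and ?y = "const_smult M E (d k) (w k)"
  have car: "?a \<in> carrier E" "?b \<in> carrier E" "?x \<in> carrier E" "?y \<in> carrier E" using Suc.prems by auto
  have "(?a \<oplus>\<^bsub>E\<^esub> ?x) \<ominus>\<^bsub>E\<^esub> (?b \<oplus>\<^bsub>E\<^esub> ?y) = (?a \<ominus>\<^bsub>E\<^esub> ?b) \<oplus>\<^bsub>E\<^esub> (?x \<ominus>\<^bsub>E\<^esub> ?y)"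
    using car by (simp add: M.minus_eq M.minus_add M.a_ac)
  then have "AE \<omega> in M. dst E (comb M E c v (Suc k)) (comb M E d w (Suc k)) \<omega>
      \<le> dst E ?a ?b \<omega> + dst E ?x ?y \<omega>"
    using AE_nrm_triangle[of "?a \<ominus>\<^bsub>E\<^esub> ?b" "?x \<ominus>\<^bsub>E\<^esub> ?y"] car by (simp add: dst_def)
  moreover have "AE \<omega> in M. dst E ?a ?b \<omega>
      \<le> (\<Sum>i<k. dst E (const_smult M E (c i) (v i)) (const_smult M E (d i) (w i)) \<omega>)"
    using Suc by auto
  ultimately show ?case by eventually_elim simp
qed

lemma AE_dst_comb_weights:
  assumes v: "\<And>i. i < k \<Longrightarrow> v i \<in> carrier E"
  shows "AE \<omega> in M. dst E (comb M E c v k) (comb M E d v k) \<omega> \<le> (\<Sum>i<k. \<bar>c i - d i\<bar> * nrm E (v i) \<omega>)"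
proof -
  have "AE \<omega> in M. \<forall>i\<in>{..<k}. dst E (const_smult M E (c i) (v i)) (const_smult M E (d i) (v i)) \<omega>
      = \<bar>c i - d i\<bar> * nrm E (v i) \<omega>"
    using AE_nrm_const_smult v
    by (intro AE_finite_allI) (auto simp: dst_def const_smult_diff[symmetric])
  moreover have "AE \<omega> in M. dst E (comb M E c v k) (comb M E d v k) \<omega>
      \<le> (\<Sum>i<k. dst E (const_smult M E (c i) (v i)) (const_smult M E (d i) (v i)) \<omega>)"
    by (rule AE_dst_comb) (simp_all add: v)
  ultimately show ?thesis by eventually_elim simp
qed

lemma AE_dst_comb_points:
  assumes v: "\<And>i. i < k \<Longrightarrow> v i \<in> carrier E" and w: "\<And>i. i < k \<Longrightarrow> w i \<in> carrier E"
  shows "AE \<omega> in M. dst E (comb M E c v k) (comb M E c w k) \<omega> \<le> (\<Sum>i<k. \<bar>c i\<bar> * dst E (v i) (w i) \<omega>)"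
proof -
  have "AE \<omega> in M. \<forall>i\<in>{..<k}. dst E (const_smult M E (c i) (v i)) (const_smult M E (c i) (w i)) \<omega>
      = \<bar>c i\<bar> * dst E (v i) (w i) \<omega>"
    using AE_nrm_const_smult v w
    by (intro AE_finite_allI) (auto simp: dst_def const_smult_r_minus[symmetric])
  moreover have "AE \<omega> in M. dst E (comb M E c v k) (comb M E c w k) \<omega>
      \<le> (\<Sum>i<k. dst E (const_smult M E (c i) (v i)) (const_smult M E (c i) (w i)) \<omega>)"
    by (rule AE_dst_comb) (simp_all add: v w)
  ultimately show ?thesis by eventually_elim simp
qed

end

section \<open>Topologies and compactness\<close>

context rn_module
begin

lemma prob_le_of_AE_disjoint:
  assumes [measurable]: "Measurable.pred M P" "Measurable.pred M Q"
    and "AE \<omega> in M. \<not> (P \<omega> \<and> Q \<omega>)"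
  shows "prob {\<omega> \<in> space M. P \<omega>} + prob {\<omega> \<in> space M. Q \<omega>} \<le> 1"
proof -
  have "prob {\<omega> \<in> space M. P \<omega>} \<le> prob (space M - {\<omega> \<in> space M. Q \<omega>})"
    using assms(3) by (intro finite_measure_mono_AE) auto
  then show ?thesis by (subst (asm) prob_compl) auto
qed

lemma prob_conj_ge:
  assumes [measurable]: "Measurable.pred M P" "Measurable.pred M Q"
  shows "prob {\<omega> \<in> space M. P \<omega>} + prob {\<omega> \<in> space M. Q \<omega>} - 1 \<le> prob {\<omega> \<in> space M. P \<omega> \<and> Q \<omega>}"
proof -
  have "prob {\<omega> \<in> space M. P \<omega>} \<le> prob ({\<omega> \<in> space M. P \<omega> \<and> Q \<omega>} \<union> (space M - {\<omega> \<in> space M. Q \<omega>}))"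
    by (intro finite_measure_mono) auto
  also have "\<dots> \<le> prob {\<omega> \<in> space M. P \<omega> \<and> Q \<omega>} + prob (space M - {\<omega> \<in> space M. Q \<omega>})"
    by (intro measure_Un_le) auto
  also have "prob (space M - {\<omega> \<in> space M. Q \<omega>}) = 1 - prob {\<omega> \<in> space M. Q \<omega>}"
    by (intro prob_compl) auto
  finally show ?thesis by simp
qed

text \<open>The least admissible index is measurable because there are only countably many
  candidates.\<close>

lemma measurable_selection:
  assumes [measurable]: "\<And>j. Measurable.pred M (P j)" and "AE \<omega> in M. \<exists>j. P j \<omega>"
  obtains N where "N \<in> M \<rightarrow>\<^sub>M count_space (UNIV :: nat set)" "AE \<omega> in M. P (N \<omega>) \<omega>"
proof
  show "(\<lambda>\<omega>. LEAST j. P j \<omega>) \<in> M \<rightarrow>\<^sub>M count_space UNIV" by measurable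
  show "AE \<omega> in M. P (LEAST j. P j \<omega>) \<omega>"
    using assms(2) by eventually_elim (auto intro: LeastI)
qed

section \<open>The topology of convergence in probability\<close>

lemma el_nhd_iff:
  "y \<in> el_nhd M E x \<epsilon> \<delta> \<longleftrightarrow> y \<in> carrier E \<and> prob {\<omega> \<in> space M. dst E y x \<omega> < \<epsilon>} > 1 - \<delta>"
  by (simp add: el_nhd_def dst_def nrm_def)

text \<open>Continuity of the measure from below allows \<open>\<epsilon>\<close> to be lowered
  slightly while the probability stays above \<open>1 - \<delta>\<close>; the gap absorbs the
  triangle inequality.\<close>

lemma openin_el_nhd:
  assumes z: "z \<in> carrier E"
  shows "openin (el_topology M E) (el_nhd M E z \<epsilon> \<delta>)"
  unfolding openin_el_topology
proof (intro conjI ballI)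
  show "el_nhd M E z \<epsilon> \<delta> \<subseteq> carrier E" by (auto simp: el_nhd_iff)
  fix x assume "x \<in> el_nhd M E z \<epsilon> \<delta>"
  then have x: "x \<in> carrier E" and p: "1 - \<delta> < prob {\<omega> \<in> space M. dst E x z \<omega> < \<epsilon>}"
    by (auto simp: el_nhd_iff)
  have [measurable]: "dst E x z \<in> borel_measurable M" using x z by simp
  define A where "A = (\<lambda>n::nat. {\<omega> \<in> space M. dst E x z \<omega> < \<epsilon> - inverse (real (Suc n))})"
  have "incseq A"
  proof (intro incseq_SucI subsetI)
    fix n \<omega> assume "\<omega> \<in> A n"
    moreover have "inverse (real (Suc (Suc n))) \<le> inverse (real (Suc n))" by (intro le_imp_inverse_le) auto
    ultimately show "\<omega> \<in> A (Suc n)" unfolding A_def mem_Collect_eq by linarith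
  qed
  moreover have "range A \<subseteq> sets M" by (auto simp: A_def)
  ultimately have lim: "(\<lambda>n. prob (A n)) \<longlonglongrightarrow> prob (\<Union>n. A n)"
    by (intro finite_Lim_measure_incseq)
  have "(\<Union>n. A n) = {\<omega> \<in> space M. dst E x z \<omega> < \<epsilon>}"
  proof (intro equalityI subsetI)
    fix \<omega> assume "\<omega> \<in> (\<Union>n. A n)"
    then obtain n where n: "\<omega> \<in> space M" "dst E x z \<omega> < \<epsilon> - inverse (real (Suc n))" by (auto simp: A_def)
    moreover have "inverse (real (Suc n)) > 0" by simp
    ultimately have "dst E x z \<omega> < \<epsilon>" by linarith
    then show "\<omega> \<in> {\<omega> \<in> space M. dst E x z \<omega> < \<epsilon>}" using n by simp
  next
    fix \<omega> assume w: "\<omega> \<in> {\<omega> \<in> space M. dst E x z \<omega> < \<epsilon>}"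
    then obtain n where "inverse (real (Suc n)) < \<epsilon> - dst E x z \<omega>"
      using reals_Archimedean[of "\<epsilon> - dst E x z \<omega>"] by auto
    then show "\<omega> \<in> (\<Union>n. A n)" using w by (auto simp: A_def intro!: exI[of _ n])
  qed
  with lim p have "eventually (\<lambda>n. prob (A n) > 1 - \<delta>) sequentially"
    by (intro order_tendstoD(1)[OF lim]) auto
  then obtain n where n: "prob (A n) > 1 - \<delta>" by (auto simp: eventually_sequentially)
  \<comment> \<open>The three terms are the slack in the radius, the slack in the probability, and a
    cap that keeps \<open>\<eta>\<close> below \<open>1\<close>.\<close>
  define \<eta> where "\<eta> = min (inverse (real (Suc n))) (min (prob (A n) - (1 - \<delta>)) (1/2))"
  have \<eta>: "0 < \<eta>" "\<eta> < 1" "\<eta> \<le> inverse (real (Suc n))" "\<eta> \<le> prob (A n) - (1 - \<delta>)"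
    using n by (auto simp: \<eta>_def)
  have "el_nhd M E x \<eta> \<eta> \<subseteq> el_nhd M E z \<epsilon> \<delta>"
  proof
    fix w assume "w \<in> el_nhd M E x \<eta> \<eta>"
    then have w: "w \<in> carrier E" and pw: "1 - \<eta> < prob {\<omega> \<in> space M. dst E w x \<omega> < \<eta>}"
      by (auto simp: el_nhd_iff)
    have [measurable]: "dst E w x \<in> borel_measurable M" "dst E w z \<in> borel_measurable M" using w x z by simp_all
    have "1 - \<delta> < prob {\<omega> \<in> space M. dst E x z \<omega> < \<epsilon> - inverse (real (Suc n)) \<and> dst E w x \<omega> < \<eta>}"
      using prob_conj_ge[of "\<lambda>\<omega>. dst E x z \<omega> < \<epsilon> - inverse (real (Suc n))" "\<lambda>\<omega>. dst E w x \<omega> < \<eta>"]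
        pw \<eta>(4) by (simp add: A_def)
    also have "\<dots> \<le> prob {\<omega> \<in> space M. dst E w z \<omega> < \<epsilon>}"
      using AE_dst_triangle[OF w x z] \<eta>(3) by (intro finite_measure_mono_AE) auto
    finally show "w \<in> el_nhd M E z \<epsilon> \<delta>" using w by (simp add: el_nhd_iff)
  qed
  then show "\<exists>\<epsilon>'>0. \<exists>\<delta>'. 0 < \<delta>' \<and> \<delta>' < 1 \<and> el_nhd M E x \<epsilon>' \<delta>' \<subseteq> el_nhd M E z \<epsilon> \<delta>"
    using \<eta> by blast
qed

lemma limitin_elD:
  assumes lim: "limitin (el_topology M E) y z sequentially" and z: "z \<in> carrier E" and "\<epsilon> > 0" "\<delta> > 0"
  shows "eventually (\<lambda>k. prob {\<omega> \<in> space M. dst E (y k) z \<omega> < \<epsilon>} > 1 - \<delta>) sequentially"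
proof -
  have "prob {\<omega> \<in> space M. dst E z z \<omega> < \<epsilon>} = prob (space M)"
    using AE_dst_self[OF z] z \<open>\<epsilon> > 0\<close> by (intro finite_measure_eq_AE) (auto elim!: eventually_mono)
  then have "z \<in> el_nhd M E z \<epsilon> \<delta>" using z \<open>\<delta> > 0\<close> by (simp add: el_nhd_iff prob_space)
  then have "eventually (\<lambda>k. y k \<in> el_nhd M E z \<epsilon> \<delta>) sequentially"
    using lim openin_el_nhd[OF z, of \<epsilon> \<delta>] by (auto simp: limitin_def)
  then show ?thesis by eventually_elim (simp add: el_nhd_iff)
qed

section \<open>The locally \<open>L0\<close>-convex topology\<close>

lemma rn_ball_class:
  assumes "r \<in> borel_measurable M"
  shows "rn_ball M E x (L0_class M borel r) = {y \<in> carrier E. AE \<omega> in M. dst E y x \<omega> < r \<omega>}"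
proof -
  have "(AE \<omega> in M. dst E y x \<omega> < rep (L0_class M borel r) \<omega>) \<longleftrightarrow> (AE \<omega> in M. dst E y x \<omega> < r \<omega>)" for y
    using rep_class(2)[OF assms] by (auto elim: eventually_elim2)
  then show ?thesis by (simp add: rn_ball_def L0_less_def dst_def nrm_def)
qed

lemma L0_pos_class:
  assumes "r \<in> borel_measurable M"
  shows "L0_class M borel r \<in> L0_pos M \<longleftrightarrow> (AE \<omega> in M. r \<omega> > 0)"
proof -
  have "AE \<omega> in M. rep (L0_class M borel (\<lambda>_. 0::real)) \<omega> = 0" by (rule rep_class) simp
  then have "AE \<omega> in M. rep (L0_class M borel (\<lambda>_. 0)) \<omega> < rep (L0_class M borel r) \<omega> \<longleftrightarrow> r \<omega> > 0"
    using rep_class(2)[OF assms] by eventually_elim simp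
  then have "(AE \<omega> in M. rep (L0_class M borel (\<lambda>_. 0)) \<omega> < rep (L0_class M borel r) \<omega>) \<longleftrightarrow> (AE \<omega> in M. r \<omega> > 0)"
    by (rule eventually_subst)
  then show ?thesis using assms by (simp add: L0_pos_def L0_less_def L0_ring_simps L0_classI)
qed

lemma openin_Tc_ball:
  assumes "r \<in> borel_measurable M" "AE \<omega> in M. r \<omega> > 0" "x \<in> carrier E"
  shows "openin (Tc_topology M E) {y \<in> carrier E. AE \<omega> in M. dst E y x \<omega> < r \<omega>}"
  unfolding Tc_topology_def
  using assms rn_ball_class[of r x] L0_pos_class[of r] by (intro topology_generated_by_Basis) auto

text \<open>The balls enter \<open>Tc_topology\<close> as a subbasis, so the proof is by induction
  on the generation of open sets. Intersections take the minimum of two random radii, and a ball is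
  recentred at \<open>x\<close> with the radius reduced by the random distance from \<open>x\<close>
  to its centre.\<close>

lemma openin_Tc_contains_ball:
  assumes W: "openin (Tc_topology M E) W" and x: "x \<in> W"
  obtains r where "r \<in> borel_measurable M" "AE \<omega> in M. r \<omega> > 0"
    "{y \<in> carrier E. AE \<omega> in M. dst E y x \<omega> < r \<omega>} \<subseteq> W"
proof -
  let ?B = "\<lambda>x r. {y \<in> carrier E. AE \<omega> in M. dst E y x \<omega> < r \<omega>}"
  have "generate_topology_on {rn_ball M E x r | x r. x \<in> carrier E \<and> r \<in> L0_pos M} W"
    using W by (simp add: Tc_topology_def openin_topology_generated_by_iff)
  then have "\<forall>x\<in>W. \<exists>r. r \<in> borel_measurable M \<and> (AE \<omega> in M. r \<omega> > 0) \<and> ?B x r \<subseteq> W"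
  proof induction
    case (Int a b)
    show ?case
    proof
      fix x assume x: "x \<in> a \<inter> b"
      obtain r where r: "r \<in> borel_measurable M" "AE \<omega> in M. r \<omega> > 0" "?B x r \<subseteq> a" using Int x by blast
      obtain s where s: "s \<in> borel_measurable M" "AE \<omega> in M. s \<omega> > 0" "?B x s \<subseteq> b" using Int x by blast
      have "?B x (\<lambda>\<omega>. min (r \<omega>) (s \<omega>)) \<subseteq> a \<inter> b" using r(3) s(3) by auto
      moreover have "AE \<omega> in M. min (r \<omega>) (s \<omega>) > 0" using r(2) s(2) by eventually_elim simp
      ultimately show "\<exists>r. r \<in> borel_measurable M \<and> (AE \<omega> in M. r \<omega> > 0) \<and> ?B x r \<subseteq> a \<inter> b"
        using r(1) s(1) by (intro exI[of _ "\<lambda>\<omega>. min (r \<omega>) (s \<omega>)"]) auto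
    qed
  next
    case (UN K)
    then show ?case by (meson Union_iff Union_upper order_trans)
  next
    case (Basis s)
    then obtain x0 r0 where s: "s = rn_ball M E x0 r0" "x0 \<in> carrier E" "r0 \<in> L0_pos M" by auto
    have r0: "rep r0 \<in> borel_measurable M" using s(3) L0_rep(1)[of r0 M borel] by (simp add: L0_pos_def)
    have sB: "s = ?B x0 (rep r0)" by (simp add: s rn_ball_def L0_less_def dst_def nrm_def)
    show ?case
    proof
      fix x assume "x \<in> s"
      then have x: "x \<in> carrier E" and lt: "AE \<omega> in M. dst E x x0 \<omega> < rep r0 \<omega>" by (auto simp: sB)
      have "y \<in> s" if y: "y \<in> carrier E" and "AE \<omega> in M. dst E y x \<omega> < rep r0 \<omega> - dst E x x0 \<omega>" for y
      proof -
        have "AE \<omega> in M. dst E y x0 \<omega> < rep r0 \<omega>"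
          using that(2) AE_dst_triangle[OF y x s(2)] by eventually_elim linarith
        then show ?thesis using y by (simp add: sB)
      qed
      moreover have "AE \<omega> in M. rep r0 \<omega> - dst E x x0 \<omega> > 0" using lt by eventually_elim simp
      ultimately show "\<exists>r. r \<in> borel_measurable M \<and> (AE \<omega> in M. r \<omega> > 0) \<and> ?B x r \<subseteq> s"
        using r0 x s(2) by (intro exI[of _ "\<lambda>\<omega>. rep r0 \<omega> - dst E x x0 \<omega>"]) auto
    qed
  qed simp
  then show ?thesis using x that by blast
qed

lemma topspace_Tc: "topspace (Tc_topology M E) = carrier E"
proof
  show "topspace (Tc_topology M E) \<subseteq> carrier E"
    by (auto simp: Tc_topology_def topology_generated_by_topspace rn_ball_def)
  show "carrier E \<subseteq> topspace (Tc_topology M E)"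
  proof
    fix x assume x: "x \<in> carrier E"
    have "x \<in> {y \<in> carrier E. AE \<omega> in M. dst E y x \<omega> < (\<lambda>_. 1) \<omega>}"
      using x AE_dst_self[OF x] by (auto elim: eventually_mono)
    then show "x \<in> topspace (Tc_topology M E)"
      using openin_subset[OF openin_Tc_ball[of "\<lambda>_. 1" x]] x by auto
  qed
qed

section \<open>Consequences of random sequential compactness\<close>

lemma random_seq_compactE:
  assumes "random_seq_compact M E G" "\<And>n. x n \<in> G"
  obtains N z where "\<And>k. N k \<in> M \<rightarrow>\<^sub>M count_space (UNIV :: nat set)" "\<And>k. AE \<omega> in M. N k \<omega> < N (Suc k) \<omega>"
    "z \<in> G" "limitin (el_topology M E) (\<lambda>k. select M E (N k) x) z sequentially"
proof -
  obtain y z where yz: "random_subseq M E x y" "z \<in> G" "limitin (el_topology M E) y z sequentially"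
    using assms unfolding random_seq_compact_def by meson
  obtain N where N: "\<And>k. N k \<in> M \<rightarrow>\<^sub>M count_space UNIV" "\<And>k. AE \<omega> in M. N k \<omega> < N (Suc k) \<omega>"
    "\<And>k. y k = select M E (N k) x"
    using random_subseqE[OF yz(1)] by blast
  have "y = (\<lambda>k. select M E (N k) x)" using N(3) by auto
  then show ?thesis using that N yz by blast
qed

text \<open>On the event that all \<open>X m\<close> with \<open>m \<ge> m0\<close> stay away from
  \<open>z\<close>, so does every selected term with \<open>k \<ge> m0\<close>, because
  \<open>N k \<ge> k\<close> almost surely. Convergence in probability therefore makes this event
  null.\<close>

lemma AE_cluster:
  assumes G: "sigma_stable M E G" and X: "\<And>n. X n \<in> G" and z: "z \<in> carrier E"
    and N: "\<And>k. N k \<in> M \<rightarrow>\<^sub>M count_space UNIV" and inc: "\<And>k. AE \<omega> in M. N k \<omega> < N (Suc k) \<omega>"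
    and lim: "limitin (el_topology M E) (\<lambda>k. select M E (N k) X) z sequentially"
  shows "AE \<omega> in M. \<forall>m0. \<forall>e>0. \<exists>m\<ge>m0. dst E (X m) z \<omega> < e"
proof -
  have Xc: "X n \<in> carrier E" for n using X G by (auto intro: sigma_stableD)
  then have [measurable]: "dst E (X n) z \<in> borel_measurable M" for n using z by simp
  have "AE \<omega> in M. \<forall>k. N k \<omega> < N (Suc k) \<omega>" using inc by (simp add: AE_all_countable)
  then have Nk: "AE \<omega> in M. \<forall>k. k \<le> N k \<omega>"
  proof eventually_elim
    case (elim \<omega>)
    then have "strict_mono (\<lambda>k. N k \<omega>)" by (simp add: strict_mono_Suc_iff)
    then show ?case by (auto intro: strict_mono_imp_increasing)
  qed
  have step: "AE \<omega> in M. \<exists>m\<ge>m0. dst E (X m) z \<omega> < e" if e: "e > 0" for m0 and e :: real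
  proof -
    let ?C = "\<lambda>\<omega>. \<forall>m\<ge>m0. \<not> dst E (X m) z \<omega> < e"
    have "prob {\<omega> \<in> space M. ?C \<omega>} = 0"
    proof (rule ccontr)
      assume "prob {\<omega> \<in> space M. ?C \<omega>} \<noteq> 0"
      then have pos: "prob {\<omega> \<in> space M. ?C \<omega>} > 0" by (simp add: less_le)
      obtain K where K: "\<And>k. k \<ge> K \<Longrightarrow> prob {\<omega> \<in> space M. dst E (select M E (N k) X) z \<omega> < e}
          > 1 - prob {\<omega> \<in> space M. ?C \<omega>}"
        using limitin_elD[OF lim z e pos] by (auto simp: eventually_sequentially)
      let ?k = "max K m0"
      have sc: "select M E (N ?k) X \<in> carrier E"
        using select_props(1)[of G X "N ?k", OF G X N] sigma_stableD[OF G] by blast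
      then have [measurable]: "dst E (select M E (N ?k) X) z \<in> borel_measurable M" using z by simp
      have "AE \<omega> in M. \<not> (?C \<omega> \<and> dst E (select M E (N ?k) X) z \<omega> < e)"
        using Nk AE_dst_select_left[of G X "N ?k", OF G X N z]
      proof eventually_elim
        case (elim \<omega>)
        have "m0 \<le> N ?k \<omega>" using elim(1) by (meson max.cobounded2 le_trans)
        then show ?case using elim(2) by auto
      qed
      then have "prob {\<omega> \<in> space M. ?C \<omega>} + prob {\<omega> \<in> space M. dst E (select M E (N ?k) X) z \<omega> < e} \<le> 1"
        by (intro prob_le_of_AE_disjoint) measurable
      then show False using K[of ?k] by simp
    qed
    then have "AE \<omega> in M. \<not> ?C \<omega>" by (subst (asm) prob_eq_0) (auto elim: eventually_mono)
    then show ?thesis by eventually_elim auto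
  qed
  have "AE \<omega> in M. \<forall>m0 n. \<exists>m\<ge>m0. dst E (X m) z \<omega> < inverse (real (Suc n))"
    unfolding AE_all_countable by (intro allI step) simp
  then show ?thesis
  proof eventually_elim
    case (elim \<omega>)
    show ?case
    proof (intro allI impI)
      fix m0 and e :: real assume "e > 0"
      then obtain n where "inverse (real (Suc n)) < e" using reals_Archimedean by blast
      then show "\<exists>m\<ge>m0. dst E (X m) z \<omega> < e" using elim by (meson less_trans)
    qed
  qed
qed

text \<open>On the event \<open>?B\<close> that no initial segment is an \<open>e\<close>-net, a
  greedy choice of indices produces an \<open>e\<close>-separated random sequence. If
  \<open>?B\<close> had positive probability, two consecutive terms of a convergent random
  subsequence would come within \<open>e\<close> of each other on part of it.\<close>

lemma AE_totally_bounded: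
  fixes x :: "nat \<Rightarrow> 'e"
  assumes rsc: "random_seq_compact M E G" and G: "sigma_stable M E G" and x: "\<And>n. x n \<in> G"
    and e: "e > 0"
  shows "AE \<omega> in M. \<exists>k. \<forall>j. \<exists>i<k. dst E (x j) (x i) \<omega> < e"
proof -
  have xc: "x n \<in> carrier E" for n using x G by (auto intro: sigma_stableD)
  then have [measurable]: "dst E (x n) (x m) \<in> borel_measurable M" for n m by simp
  let ?far = "\<lambda>j (n::nat) \<omega>. \<forall>i\<le>n. \<not> dst E (x j) (x i) \<omega> < e"
  let ?B = "\<lambda>\<omega>. \<forall>k. \<exists>j. \<forall>i<k. \<not> dst E (x j) (x i) \<omega> < e"
  \<comment> \<open>The next index is far from all indices up to the current one, not only from
    those chosen before. Off \<open>?B\<close> the value of \<open>LEAST\<close> is immaterial; only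
    measurability matters there.\<close>
  define N where "N = rec_nat (\<lambda>_. 0 :: nat) (\<lambda>s n \<omega>. LEAST j. ?far j (n \<omega>) \<omega>)"
  have NSuc: "N (Suc s) = (\<lambda>\<omega>. LEAST j. ?far j (N s \<omega>) \<omega>)" for s by (simp add: N_def)
  have N: "N s \<in> M \<rightarrow>\<^sub>M count_space UNIV" for s
  proof (induction s)
    case 0
    then show ?case by (simp add: N_def)
  next
    case (Suc s)
    note [measurable] = Suc
    show ?case unfolding NSuc
      by (rule measurable_compose_countable[of "\<lambda>n \<omega>. LEAST j. ?far j n \<omega>" _ _ "N s"]) measurable
  qed
  define z where "z = (\<lambda>s. select M E (N s) x)"
  have zG: "z s \<in> G" for s unfolding z_def using select_props(1)[of G x "N s", OF G x N] .
  have self: "AE \<omega> in M. \<forall>i. dst E (x i) (x i) \<omega> = 0"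
    unfolding AE_all_countable using AE_dst_self xc by blast
  have sel: "AE \<omega> in M. \<forall>s t. dst E (z s) (z t) \<omega> = dst E (x (N s \<omega>)) (x (N t \<omega>)) \<omega>"
    unfolding AE_all_countable z_def using AE_dst_select[of G x _ G x, OF G x N G x N] by blast
  have sep: "AE \<omega> in M. ?B \<omega> \<longrightarrow> (\<forall>s t. s < t \<longrightarrow> \<not> dst E (z t) (z s) \<omega> < e)"
    using self sel
  proof eventually_elim
    case (elim \<omega>)
    show ?case
    proof (intro impI allI)
      fix s t :: nat assume B: "?B \<omega>" and st: "s < t"
      have far: "?far (N (Suc s) \<omega>) (N s \<omega>) \<omega>" for s
      proof -
        obtain j where "?far j (N s \<omega>) \<omega>" using B[rule_format, of "Suc (N s \<omega>)"] by (auto simp: less_Suc_eq_le)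
        then show ?thesis unfolding NSuc by (rule LeastI)
      qed
      \<comment> \<open>An index not exceeding \<open>N s \<omega>\<close> would have to be far from
        itself.\<close>
      have "N s \<omega> < N (Suc s) \<omega>" for s
      proof (rule ccontr)
        assume "\<not> N s \<omega> < N (Suc s) \<omega>"
        then have "N (Suc s) \<omega> \<le> N s \<omega>" by simp
        then have "\<not> dst E (x (N (Suc s) \<omega>)) (x (N (Suc s) \<omega>)) \<omega> < e" using far by blast
        then show False using elim(1) e by simp
      qed
      then have mono: "mono (\<lambda>s. N s \<omega>)" by (intro incseq_SucI less_imp_le)
      obtain t' where t': "t = Suc t'" "s \<le> t'" using st by (cases t) auto
      have "N s \<omega> \<le> N t' \<omega>" using mono t'(2) by (auto dest: monoD)
      then show "\<not> dst E (z t) (z s) \<omega> < e" using far[of t'] elim(2) t'(1) by auto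
    qed
  qed
  obtain K w where K: "\<And>k. K k \<in> M \<rightarrow>\<^sub>M count_space (UNIV :: nat set)"
    "\<And>k. AE \<omega> in M. K k \<omega> < K (Suc k) \<omega>" and w: "w \<in> G"
    and lim: "limitin (el_topology M E) (\<lambda>k. select M E (K k) z) w sequentially"
    using random_seq_compactE[of G z, OF rsc zG] by blast
  have wc: "w \<in> carrier E" using G w by (rule sigma_stableD)
  let ?y = "\<lambda>k. select M E (K k) z"
  have yc: "?y k \<in> carrier E" for k
    using select_props(1)[of G z "K k", OF G zG K(1)] sigma_stableD[OF G] by blast
  then have [measurable]: "dst E (?y k) w \<in> borel_measurable M" for k using wc by simp
  have "prob {\<omega> \<in> space M. ?B \<omega>} = 0"
  proof (rule ccontr)
    assume "prob {\<omega> \<in> space M. ?B \<omega>} \<noteq> 0"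
    \<comment> \<open>Half the probability of \<open>?B\<close> is allotted to each of the two
      closeness events, so that both together must still meet \<open>?B\<close>.\<close>
    then have pos: "prob {\<omega> \<in> space M. ?B \<omega>} / 2 > 0" by (simp add: less_le)
    have e2: "e / 2 > 0" using e by simp
    obtain k where k: "prob {\<omega> \<in> space M. dst E (?y k) w \<omega> < e / 2} > 1 - prob {\<omega> \<in> space M. ?B \<omega>} / 2"
        "prob {\<omega> \<in> space M. dst E (?y (Suc k)) w \<omega> < e / 2} > 1 - prob {\<omega> \<in> space M. ?B \<omega>} / 2"
      using limitin_elD[OF lim wc e2 pos] unfolding eventually_sequentially by (meson le_refl le_SucI)
    have "AE \<omega> in M. \<not> (?B \<omega> \<and> dst E (?y k) w \<omega> < e / 2 \<and> dst E (?y (Suc k)) w \<omega> < e / 2)"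
      using sep K(2)[of k] AE_dst_select[of G z "K (Suc k)" G z "K k", OF G zG K(1) G zG K(1)]
        AE_dst_triangle[OF yc[of "Suc k"] wc yc[of k]] AE_dst_commute[OF yc[of k] wc]
    proof eventually_elim
      case (elim \<omega>)
      then show ?case by auto (smt (verit) field_sum_of_halves)
    qed
    then have "prob {\<omega> \<in> space M. ?B \<omega>}
        + prob {\<omega> \<in> space M. dst E (?y k) w \<omega> < e / 2 \<and> dst E (?y (Suc k)) w \<omega> < e / 2} \<le> 1"
      by (intro prob_le_of_AE_disjoint) measurable
    moreover have "prob {\<omega> \<in> space M. dst E (?y k) w \<omega> < e / 2} + prob {\<omega> \<in> space M. dst E (?y (Suc k)) w \<omega> < e / 2} - 1
        \<le> prob {\<omega> \<in> space M. dst E (?y k) w \<omega> < e / 2 \<and> dst E (?y (Suc k)) w \<omega> < e / 2}"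
      by (intro prob_conj_ge) measurable
    ultimately show False using k by linarith
  qed
  then have "AE \<omega> in M. \<not> ?B \<omega>" by (subst (asm) prob_eq_0) (auto elim: eventually_mono)
  then show ?thesis by eventually_elim auto
qed

end

section \<open>Approximate fixed points\<close>

text \<open>Rational weights are stored as natural numbers and normalized here, which matches the
  integer grid of Kuhn's lemma. A weight sum of \<open>0\<close> turns all weights into
  \<open>0\<close>, so membership in a convex set is claimed only for positive sums.\<close>

definition mean :: "'a measure \<Rightarrow>
    ('a, 'k::{real_normed_field, second_countable_topology}, 'e, 'z) rn_module_scheme \<Rightarrow>
    nat \<Rightarrow> (nat \<Rightarrow> nat) \<Rightarrow> (nat \<Rightarrow> 'e) \<Rightarrow> 'e" where
  "mean M E k q v = comb M E (\<lambda>i. real (q i) / real (sum q {..<k})) v k"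

lemma comb_cong:
  "(\<And>i. i < k \<Longrightarrow> c i = d i) \<Longrightarrow> (\<And>i. i < k \<Longrightarrow> v i = w i) \<Longrightarrow> comb M E c v k = comb M E d w k"
  by (induction k) auto

lemma mean_cong:
  assumes "\<And>i. i < k \<Longrightarrow> q i = r i" "\<And>i. i < k \<Longrightarrow> v i = w i"
  shows "mean M E k q v = mean M E k r w"
proof -
  have "sum q {..<k} = sum r {..<k}" using assms(1) by (intro sum.cong) auto
  then show ?thesis unfolding mean_def using assms by (intro comb_cong) auto
qed

context rn_module
begin

lemma mean_closed [simp, intro]: "(\<And>i. i < k \<Longrightarrow> v i \<in> carrier E) \<Longrightarrow> mean M E k q v \<in> carrier E"
  unfolding mean_def by (rule comb_closed)

lemma mean_in_convex:
  assumes G: "L0_convex M E G" and v: "\<And>i. i < k \<Longrightarrow> v i \<in> G" and q: "sum q {..<k} > 0"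
  shows "mean M E k q v \<in> G"
proof -
  let ?c = "\<lambda>i. real (q i) / real (sum q {..<k})"
  have "sum ?c {..<k} = real (sum q {..<k}) / real (sum q {..<k})"
    by (simp only: sum_divide_distrib of_nat_sum)
  then have "sum ?c {..<k} = 1" using q by (metis divide_self less_irrefl of_nat_0_eq_iff)
  then have "const_smult M E (1 / 1) (comb M E ?c v k) \<in> G"
    using v by (intro comb_in_convex[OF G]) (auto simp del: of_nat_sum)
  moreover have "comb M E ?c v k \<in> carrier E"
    using v G by (intro comb_closed) (auto simp: L0_convex_def)
  ultimately show ?thesis by (simp add: mean_def)
qed

text \<open>Supplies the Lipschitz hypothesis of \<open>kuhn_weights\<close>.\<close>

lemma AE_dst_mean_weights:
  assumes v: "\<And>i. i < k \<Longrightarrow> v i \<in> carrier E"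
  shows "AE \<omega> in M. dst E (mean M E k q v) (mean M E k r v) \<omega>
    \<le> (\<Sum>i<k. \<bar>real (q i) / real (sum q {..<k}) - real (r i) / real (sum r {..<k})\<bar> * nrm E (v i) \<omega>)"
  unfolding mean_def using v by (rule AE_dst_comb_weights)

text \<open>Used to replace values of \<open>F\<close> at nearby points by elements of
  \<open>F z\<close>; points of weight \<open>0\<close> contribute nothing.\<close>

lemma AE_dst_mean_points:
  assumes v: "\<And>i. i < k \<Longrightarrow> v i \<in> carrier E" and w: "\<And>i. i < k \<Longrightarrow> w i \<in> carrier E"
  shows "AE \<omega> in M. dst E (mean M E k q v) (mean M E k q w) \<omega>
    \<le> (\<Sum>i<k. real (q i) / real (sum q {..<k}) * dst E (v i) (w i) \<omega>)"
proof -
  have "AE \<omega> in M. dst E (mean M E k q v) (mean M E k q w) \<omega>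
    \<le> (\<Sum>i<k. \<bar>real (q i) / real (sum q {..<k})\<bar> * dst E (v i) (w i) \<omega>)"
    unfolding mean_def by (rule AE_dst_comb_points) (simp_all add: v w)
  moreover have "\<bar>real a / real b\<bar> = real a / real b" for a b :: nat by simp
  ultimately show ?thesis by (simp only:)
qed

text \<open>Starting from one point, all averages of \<open>f\<close>-images of points found so far
  are added repeatedly. Each stage is countable, being indexed by lists of weight and point pairs,
  and finitely many points of the union lie in a common stage because the stages increase.\<close>

lemma exists_mean_closed_sequence:
  assumes G: "L0_convex M E G" and f: "\<And>x. x \<in> G \<Longrightarrow> f x \<in> G"
  obtains x :: "nat \<Rightarrow> 'e" where "\<And>n. x n \<in> G"
    "\<And>k q. sum q {..<k} > 0 \<Longrightarrow> \<exists>j. mean M E k q (\<lambda>i. f (x i)) = x j"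
proof -
  obtain g where g: "g \<in> G" using G by (auto simp: L0_convex_def)
  \<comment> \<open>The default \<open>g\<close> keeps \<open>T\<close> inside \<open>G\<close> for
    lists whose weights sum to \<open>0\<close>.\<close>
  define T where "T = (\<lambda>l. if sum (\<lambda>i. fst (l ! i)) {..<length l} > 0
    then mean M E (length l) (\<lambda>i. fst (l ! i)) (\<lambda>i. f (snd (l ! i))) else g)"
  define D where "D = rec_nat {g} (\<lambda>n A. A \<union> T ` lists (UNIV \<times> A))"
  have D0: "D 0 = {g}" and DS: "D (Suc n) = D n \<union> T ` lists (UNIV \<times> D n)" for n
    by (simp_all add: D_def)
  have count: "countable (D n)" for n by (induction n) (simp_all add: D0 DS)
  have DG: "D n \<subseteq> G" for n
  proof (induction n)
    case (Suc n)
    have "T l \<in> G" if "l \<in> lists (UNIV \<times> D n)" for l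
    proof (cases "sum (\<lambda>i. fst (l ! i)) {..<length l} > 0")
      case True
      have "snd (l ! i) \<in> G" if "i < length l" for i
        using Suc in_listsD[OF \<open>l \<in> lists (UNIV \<times> D n)\<close>] nth_mem[OF that]
        by (auto simp: mem_Times_iff)
      then show ?thesis unfolding T_def using True f by (auto intro!: mean_in_convex[OF G])
    qed (simp add: T_def g)
    then show ?case using Suc by (auto simp: DS)
  qed (simp add: D0 g)
  have mono: "D m \<subseteq> D n" if "m \<le> n" for m n
    using that by (rule lift_Suc_mono_le[rotated]) (simp add: DS)
  define A where "A = (\<Union>n. D n)"
  have A: "A \<noteq> {}" "countable A" using count D0 by (auto simp: A_def)
  define x where "x = from_nat_into A"
  have rx: "range x = A" using A by (simp add: x_def range_from_nat_into)
  show ?thesis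
  proof
    show "x n \<in> G" for n using rx DG by (auto simp: A_def)
    fix k and q :: "nat \<Rightarrow> nat" assume q: "sum q {..<k} > 0"
    have "\<exists>n. \<forall>i<k. x i \<in> D n"
    proof (induction k)
      case (Suc k)
      then obtain n where n: "\<forall>i<k. x i \<in> D n" by blast
      obtain m where "x k \<in> D m" using rx by (auto simp: A_def)
      then show ?case using n mono[of n "max n m"] mono[of m "max n m"]
        by (intro exI[of _ "max n m"]) (auto simp: less_Suc_eq)
    qed simp
    then obtain n where n: "\<And>i. i < k \<Longrightarrow> x i \<in> D n" by blast
    define l where "l = map (\<lambda>i. (q i, x i)) [0..<k]"
    have l: "length l = k" "\<And>i. i < k \<Longrightarrow> l ! i = (q i, x i)" by (simp_all add: l_def)
    have "l \<in> lists (UNIV \<times> D n)" using n by (auto simp: l_def)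
    then have "T l \<in> A" unfolding A_def using DS[of n] by blast
    moreover have "sum (\<lambda>i. fst (l ! i)) {..<k} = sum q {..<k}" using l by (intro sum.cong) auto
    then have "T l = mean M E k (\<lambda>i. fst (l ! i)) (\<lambda>i. f (snd (l ! i)))"
      unfolding T_def l(1) using q by simp
    moreover have "\<dots> = mean M E k q (\<lambda>i. f (x i))" using l by (intro mean_cong) auto
    ultimately show "\<exists>j. mean M E k q (\<lambda>i. f (x i)) = x j" using rx by (metis imageE)
  qed
qed

text \<open>At a good outcome the first \<open>k\<close> points form a net of the whole sequence. By
  \<open>cl\<close> every average is itself a point of the sequence, so it is near a net point, as
  \<open>kuhn_weights\<close> demands.\<close>

lemma AE_approximate_fixed_point:
  assumes x: "\<And>n. x n \<in> carrier E" and y: "\<And>n. y n \<in> carrier E"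
    and cl: "\<And>k q. sum q {..<k} > 0 \<Longrightarrow> \<exists>j. mean M E k q y = x j"
    and tb: "\<And>e. e > 0 \<Longrightarrow> AE \<omega> in M. \<exists>k. \<forall>j. \<exists>i<k. dst E (x j) (x i) \<omega> < e"
    and e: "e > 0"
  shows "AE \<omega> in M. \<exists>l. sum ((!) l) {..<length l} > 0 \<and>
    (\<forall>i<length l. l ! i > 0 \<longrightarrow> dst E (mean M E (length l) ((!) l) y) (x i) \<omega> < e)"
proof -
  \<comment> \<open>\<open>kuhn_weights\<close> is run with \<open>e / 2\<close>: it needs a net of
    mesh \<open>e / 4\<close> and returns distances below \<open>e\<close>.\<close>
  have e4: "e / 4 > 0" using e by simp
  have mc: "mean M E k q y \<in> carrier E" for k q using y by simp
  \<comment> \<open>Weights are lists because one null set has to serve all of them and lists of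
    naturals are countable, unlike functions on the naturals.\<close>
  have 1: "AE \<omega> in M. \<forall>k l l'. dst E (mean M E k ((!) l) y) (mean M E k ((!) l') y) \<omega>
      \<le> (\<Sum>i<k. \<bar>real (l ! i) / real (sum ((!) l) {..<k}) - real (l' ! i) / real (sum ((!) l') {..<k})\<bar> * nrm E (y i) \<omega>)"
    unfolding AE_all_countable using y by (intro allI AE_dst_mean_weights)
  have 2: "AE \<omega> in M. \<forall>k l l' i. dst E (mean M E k ((!) l) y) (x i) \<omega>
      \<le> dst E (mean M E k ((!) l) y) (mean M E k ((!) l') y) \<omega> + dst E (mean M E k ((!) l') y) (x i) \<omega>"
    unfolding AE_all_countable using x mc by (intro allI AE_dst_triangle) auto
  have 3: "AE \<omega> in M. \<forall>i. 0 \<le> nrm E (y i) \<omega>"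
    unfolding AE_all_countable using y by (intro allI AE_nrm_nonneg)
  show ?thesis
    using 1 2 3 tb[OF e4]
  proof eventually_elim
    case (elim \<omega>)
    obtain k where k: "\<And>j. \<exists>i<k. dst E (x j) (x i) \<omega> < e / 4" using elim(4) by blast
    then have k0: "k > 0" by (metis not_less_zero neq0_conv)
    let ?l = "\<lambda>q::nat \<Rightarrow> nat. map q [0..<k]"
    let ?m = "\<lambda>q::nat \<Rightarrow> nat. mean M E k ((!) (?l q)) y"
    define C where "C = (\<Sum>i<k. nrm E (y i) \<omega>)"
    have C: "nrm E (y i) \<omega> \<le> C" if "i < k" for i
      unfolding C_def using that elim(3) by (intro member_le_sum) auto
    have C0: "C \<ge> 0" unfolding C_def using elim(3) by (intro sum_nonneg) auto
    have sl: "sum ((!) (?l q)) {..<k} = sum q {..<k}" for q by (intro sum.cong) auto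
    have mq: "?m q = mean M E k q y" for q by (intro mean_cong) auto
    have d: "dst E (?m r) (?m q) \<omega>
        \<le> C * (\<Sum>j<k. \<bar>real (r j) / real (sum r {..<k}) - real (q j) / real (sum q {..<k})\<bar>)" for q r
    proof -
      have "dst E (?m r) (?m q) \<omega> \<le> (\<Sum>i<k. \<bar>real (?l r ! i) / real (sum ((!) (?l r)) {..<k})
          - real (?l q ! i) / real (sum ((!) (?l q)) {..<k})\<bar> * nrm E (y i) \<omega>)"
        using elim(1) by blast
      also have "\<dots> \<le> (\<Sum>i<k. \<bar>real (r i) / real (sum r {..<k}) - real (q i) / real (sum q {..<k})\<bar> * C)"
        unfolding sl using C by (intro sum_mono) (auto intro!: mult_left_mono)
      finally show ?thesis by (simp only: sum_distrib_right mult.commute[of C])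
    qed
    have osc: "\<bar>dst E (?m r) (x i) \<omega> - dst E (?m q) (x i) \<omega>\<bar>
        \<le> C * (\<Sum>j<k. \<bar>real (r j) / real (sum r {..<k}) - real (q j) / real (sum q {..<k})\<bar>)" for q r i
    proof -
      have "dst E (?m r) (x i) \<omega> \<le> dst E (?m r) (?m q) \<omega> + dst E (?m q) (x i) \<omega>"
        "dst E (?m q) (x i) \<omega> \<le> dst E (?m q) (?m r) \<omega> + dst E (?m r) (x i) \<omega>"
        using elim(2) by blast+
      then show ?thesis using d[of r q] d[of q r] by (simp add: abs_minus_commute abs_le_iff)
    qed
    have "\<exists>q. sum q {..<k} > 0 \<and> (\<forall>i<k. q i > 0 \<longrightarrow> dst E (?m q) (x i) \<omega> < 2 * (e / 2))"
    proof (rule kuhn_weights[OF k0 _ C0])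
      show "0 < e / 2" using e by simp
      show "\<exists>i<k. dst E (?m r) (x i) \<omega> < e / 2 / 2" if r: "sum r {..<k} > 0" for r
      proof -
        obtain j where "mean M E k r y = x j" using cl[OF r] by blast
        then show ?thesis using k[of j] mq by simp
      qed
    qed (rule osc)
    then obtain q where q: "sum q {..<k} > 0" "\<forall>i<k. q i > 0 \<longrightarrow> dst E (?m q) (x i) \<omega> < e" by auto
    have "length (?l q) = k" by simp
    then show ?case using q sl[of q] by (intro exI[of _ "?l q"]) auto
  qed
qed

theorem random_kakutani:
  assumes rsc: "random_seq_compact M E G" and cvx: "L0_convex M E G"
    and F: "\<And>x. x \<in> G \<Longrightarrow> F x \<noteq> {} \<and> F x \<subseteq> G"
    and st: "sigma_stable_map M E E G F" and usc: "Tc_usc M E E G F"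
    and closed: "\<And>x. x \<in> G \<Longrightarrow> closedin (Tc_topology M E) (F x)"
    and Fcvx: "\<And>x. x \<in> G \<Longrightarrow> L0_convex M E (F x)"
  shows "\<exists>z\<in>G. z \<in> F z"
proof -
  have G: "sigma_stable M E G" using st by (simp add: sigma_stable_map_def)
  have Gc: "x \<in> carrier E" if "x \<in> G" for x using G that by (rule sigma_stableD)
  obtain g where g: "g \<in> G" using cvx by (auto simp: L0_convex_def)

  \<comment> \<open>Construction of random approximate fixed points\<close>
  define f where "f = (\<lambda>x. SOME v. v \<in> F x)"
  have f: "f x \<in> F x" if "x \<in> G" for x using F[OF that] by (simp add: f_def some_in_eq)
  have fG: "f x \<in> G" if "x \<in> G" for x using f[OF that] F[OF that] by blast
  obtain x where x: "\<And>n. x n \<in> G"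
    and xcl: "\<And>k q. sum q {..<k} > 0 \<Longrightarrow> \<exists>j. mean M E k q (\<lambda>i. f (x i)) = x j"
    using exists_mean_closed_sequence[of G f, OF cvx fG] by blast
  define y where "y = (\<lambda>i. f (x i))"
  have y: "y i \<in> F (x i)" "y i \<in> G" for i using f[OF x] fG[OF x] by (auto simp: y_def)
  \<comment> \<open>Weight vectors are lists of naturals, which \<open>from_nat\<close> enumerates by codes \<open>c\<close>.\<close>
  define pos where "pos = (\<lambda>c. sum ((!) (from_nat c :: nat list)) {..<length (from_nat c :: nat list)} > 0)"
  define avg where "avg = (\<lambda>c v. mean M E (length (from_nat c :: nat list)) ((!) (from_nat c)) v)"
  define near where "near = (\<lambda>c w r \<omega>. \<forall>i<length (from_nat c :: nat list).
      (from_nat c :: nat list) ! i > 0 \<longrightarrow> dst E w (x i) \<omega> < r)"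
  \<comment> \<open>The default \<open>g\<close> puts every \<open>T c\<close> into
    \<open>G\<close>, as gluing requires of all terms, including those never selected.\<close>
  define T where "T = (\<lambda>c. if pos c then avg c y else g)"
  have TG: "T c \<in> G" for c
    using mean_in_convex[OF cvx] y(2) g by (auto simp: T_def pos_def avg_def)
  note [measurable] = dst_measurable[OF Gc Gc]
  have [measurable]: "dst E (T c) (x i) \<in> borel_measurable M" for c i using TG x by measurable
  have approx: "\<exists>N. N \<in> M \<rightarrow>\<^sub>M count_space (UNIV :: nat set) \<and>
      (AE \<omega> in M. pos (N \<omega>) \<and> near (N \<omega>) (T (N \<omega>)) (inverse (real (Suc m))) \<omega>)" for m
  proof -
    have "AE \<omega> in M. \<exists>l. sum ((!) l) {..<length l} > 0 \<and>
        (\<forall>i<length l. l ! i > 0 \<longrightarrow> dst E (mean M E (length l) ((!) l) y) (x i) \<omega> < inverse (real (Suc m)))"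
      using AE_totally_bounded[of G x, OF rsc G x] xcl Gc[OF x] Gc[OF y(2)]
      by (intro AE_approximate_fixed_point) (auto simp: y_def)
    then have ex: "AE \<omega> in M. \<exists>c. pos c \<and> near c (T c) (inverse (real (Suc m))) \<omega>"
    proof eventually_elim
      case (elim \<omega>)
      then obtain l where "sum ((!) l) {..<length l} > 0"
        "\<forall>i<length l. l ! i > 0 \<longrightarrow> dst E (mean M E (length l) ((!) l) y) (x i) \<omega> < inverse (real (Suc m))" by blast
      then show ?case by (intro exI[of _ "to_nat l"]) (simp add: pos_def near_def T_def avg_def)
    qed
    show ?thesis
      by (rule measurable_selection[OF _ ex]) (auto simp: near_def)
  qed
  then have "\<exists>N. \<forall>m. N m \<in> M \<rightarrow>\<^sub>M count_space (UNIV :: nat set) \<and>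
      (AE \<omega> in M. pos (N m \<omega>) \<and> near (N m \<omega>) (T (N m \<omega>)) (inverse (real (Suc m))) \<omega>)"
    by (intro choice allI)
  then obtain N where N: "\<And>m. N m \<in> M \<rightarrow>\<^sub>M count_space (UNIV :: nat set)"
    and approx: "\<And>m. AE \<omega> in M. pos (N m \<omega>) \<and> near (N m \<omega>) (T (N m \<omega>)) (inverse (real (Suc m))) \<omega>"
    by blast
  define X where "X = (\<lambda>m. select M E (N m) T)"
  have XG: "X m \<in> G" for m unfolding X_def using select_props(1)[of G T "N m", OF G TG N] .

  \<comment> \<open>Passage to a cluster point\<close>
  obtain K z where K: "\<And>k. K k \<in> M \<rightarrow>\<^sub>M count_space (UNIV :: nat set)"
    "\<And>k. AE \<omega> in M. K k \<omega> < K (Suc k) \<omega>" and z: "z \<in> G"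
    and lim: "limitin (el_topology M E) (\<lambda>k. select M E (K k) X) z sequentially"
    using random_seq_compactE[of G X, OF rsc XG] by blast
  have zc: "z \<in> carrier E" using z by (rule Gc)
  have cluster: "AE \<omega> in M. \<forall>m0. \<forall>e>0. \<exists>m\<ge>m0. dst E (X m) z \<omega> < e"
    using AE_cluster[of G X z K, OF G XG zc K lim] .
  have XT: "AE \<omega> in M. \<forall>m. dst E (X m) z \<omega> = dst E (T (N m \<omega>)) z \<omega>"
    unfolding AE_all_countable X_def using AE_dst_select_left[of G T "N _" z, OF G TG N zc] by blast

  \<comment> \<open>The cluster point lies in its image\<close>
  have "z \<in> F z"
  proof (rule ccontr)
    assume "z \<notin> F z"
    moreover have "openin (Tc_topology M E) (carrier E - F z)"
      using closed[OF z] by (simp add: closedin_def topspace_Tc)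
    ultimately obtain \<delta> where \<delta> [measurable]: "\<delta> \<in> borel_measurable M" and \<delta>0: "AE \<omega> in M. \<delta> \<omega> > 0"
      and \<delta>F: "{w \<in> carrier E. AE \<omega> in M. dst E w z \<omega> < \<delta> \<omega>} \<subseteq> carrier E - F z"
      using openin_Tc_contains_ball[of "carrier E - F z" z] zc by blast
    \<comment> \<open>One half of \<open>\<delta>\<close> covers the distance from an element of
      \<open>F z\<close> to an approximate fixed point, the other half the distance from there to
      \<open>z\<close>.\<close>
    define h where "h = (\<lambda>\<omega>. \<delta> \<omega> / 2)"
    have h [measurable]: "h \<in> borel_measurable M" and h0: "AE \<omega> in M. h \<omega> > 0"
      using \<delta> \<delta>0 by (auto simp: h_def)
    define U where "U = (\<Union>v\<in>F z. {w \<in> carrier E. AE \<omega> in M. dst E w v \<omega> < h \<omega>})"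
    have FzG: "F z \<subseteq> G" using F[OF z] by blast
    have "openin (Tc_topology M E) U"
      unfolding U_def using FzG Gc h h0 by (intro openin_Union) (auto intro!: openin_Tc_ball)
    moreover have "F z \<subseteq> U"
    proof
      fix v assume v: "v \<in> F z"
      have "AE \<omega> in M. dst E v v \<omega> = 0" using v FzG by (intro AE_dst_self Gc) auto
      with h0 have "AE \<omega> in M. dst E v v \<omega> < h \<omega>" by eventually_elim simp
      then show "v \<in> U" using v FzG Gc by (auto simp: U_def)
    qed
    ultimately have "set_nhd (Tc_topology M E) (F z) U"
      by (auto simp: set_nhd_def dest: openin_subset)
    then obtain V where V: "set_nhd (Tc_topology M E) {z} V" "(\<Union>v\<in>V \<inter> G. F v) \<subseteq> U"
      using usc z unfolding Tc_usc_def by blast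
    then obtain W where W: "openin (Tc_topology M E) W" "z \<in> W" "W \<subseteq> V" by (auto simp: set_nhd_def)
    obtain r where r [measurable]: "r \<in> borel_measurable M" and r0: "AE \<omega> in M. r \<omega> > 0"
      and rW: "{w \<in> carrier E. AE \<omega> in M. dst E w z \<omega> < r \<omega>} \<subseteq> W"
      using openin_Tc_contains_ball[OF W(1,2)] .
    obtain v0 where v0: "v0 \<in> F z" using F[OF z] by blast
    have "\<exists>v\<in>F z. AE \<omega> in M. dst E (x i) z \<omega> < r \<omega> \<longrightarrow> dst E (y i) v \<omega> < h \<omega>" for i
    proof -
      have [measurable]: "dst E (x i) z \<in> borel_measurable M" using x z by measurable
      \<comment> \<open>Replacing \<open>x i\<close> by \<open>z\<close> off the event \<open>dst E (x i) z < r\<close> moves it into \<open>V\<close> without changing it on the event.\<close>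
      let ?n = "\<lambda>\<omega>. if dst E (x i) z \<omega> < r \<omega> then 0 else 1 :: nat"
      have n: "?n \<in> M \<rightarrow>\<^sub>M count_space UNIV" by measurable
      let ?p = "\<lambda>n::nat. if n = 0 then x i else z"
      have p: "?p n \<in> G" for n using x z by simp
      have pG: "select M E ?n ?p \<in> G" using select_props(1)[of G ?p ?n, OF G p n] .
      have "AE \<omega> in M. dst E (select M E ?n ?p) z \<omega> < r \<omega>"
        using AE_dst_select_left[of G ?p ?n z, OF G p n zc] AE_dst_self[OF zc] r0
        by eventually_elim (auto split: if_splits)
      then have "select M E ?n ?p \<in> V" using rW W(3) pG Gc by blast
      then have FU: "F (select M E ?n ?p) \<subseteq> U" using V(2) pG by blast
      \<comment> \<open>The same index glues \<open>y i\<close> with an arbitrary \<open>v0\<close>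
        in \<open>F z\<close>, so \<open>\<sigma>\<close>-stability makes the result a value of
        \<open>F\<close> at the modified point.\<close>
      let ?u = "\<lambda>n::nat. if n = 0 then y i else v0"
      have u: "?u n \<in> G" for n using y(2) v0 FzG by auto
      have "select M E ?n ?u \<in> F (select M E ?n ?p)"
        unfolding sigma_stable_map_select[of G F ?p ?n, OF st p n] using y(1) v0 by fastforce
      then obtain v where v: "v \<in> F z" "AE \<omega> in M. dst E (select M E ?n ?u) v \<omega> < h \<omega>"
        using FU by (auto simp: U_def)
      have vc: "v \<in> carrier E" using v(1) FzG Gc by blast
      have "AE \<omega> in M. dst E (x i) z \<omega> < r \<omega> \<longrightarrow> dst E (y i) v \<omega> < h \<omega>"
        using v(2) AE_dst_select_left[of G ?u ?n v, OF G u n vc] by eventually_elim auto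
      then show ?thesis using v(1) by blast
    qed
    then have "\<exists>v. \<forall>i. v i \<in> F z \<and> (AE \<omega> in M. dst E (x i) z \<omega> < r \<omega> \<longrightarrow> dst E (y i) (v i) \<omega> < h \<omega>)"
      by (intro choice allI) blast
    then obtain v where v: "\<And>i. v i \<in> F z"
      and vy: "\<And>i. AE \<omega> in M. dst E (x i) z \<omega> < r \<omega> \<longrightarrow> dst E (y i) (v i) \<omega> < h \<omega>"
      by blast
    have vG: "v i \<in> G" for i using v FzG by blast
    \<comment> \<open>The code is chosen afresh because the index \<open>m\<close> at which
      \<open>X m\<close> is near \<open>z\<close> varies with the outcome;
      \<open>N m \<omega>\<close> only witnesses that a suitable code exists.\<close>
    define P where "P = (\<lambda>c \<omega>. pos c \<and> dst E (T c) z \<omega> < h \<omega> \<and>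
      (\<forall>i<length (from_nat c :: nat list). (from_nat c :: nat list) ! i > 0 \<longrightarrow> dst E (x i) z \<omega> < r \<omega>))"
    have [measurable]: "dst E (T c) z \<in> borel_measurable M" "dst E (x i) z \<in> borel_measurable M" for c i
      using TG x z by measurable
    have tri: "AE \<omega> in M. \<forall>i c. dst E (x i) z \<omega> \<le> dst E (T c) (x i) \<omega> + dst E (T c) z \<omega>"
    proof -
      have "AE \<omega> in M. dst E (x i) z \<omega> \<le> dst E (T c) (x i) \<omega> + dst E (T c) z \<omega>" for i c
        using AE_dst_triangle[OF Gc[OF x] Gc[OF TG] zc, of i c] AE_dst_commute[OF Gc[OF x] Gc[OF TG], of i c]
        by eventually_elim simp
      then show ?thesis by (simp add: AE_all_countable)
    qed
    have approx': "AE \<omega> in M. \<forall>m. pos (N m \<omega>) \<and> near (N m \<omega>) (T (N m \<omega>)) (inverse (real (Suc m))) \<omega>"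
      using approx by (simp only: AE_all_countable) blast
    have exP: "AE \<omega> in M. \<exists>c. P c \<omega>"
      using cluster XT tri approx' r0 h0
    proof eventually_elim
      case (elim \<omega>)
      obtain m0 where m0: "inverse (real (Suc m0)) < r \<omega> / 2"
        using reals_Archimedean[of "r \<omega> / 2"] elim(5) by auto
      \<comment> \<open>The bound \<open>h\<close> is demanded by \<open>P\<close>; the bound
        \<open>r / 2\<close>, added to \<open>inverse (real (Suc m)) < r / 2\<close>, brings the
        points of positive weight within \<open>r\<close> of \<open>z\<close>.\<close>
      have "min (h \<omega>) (r \<omega> / 2) > 0" using elim by simp
      then obtain m where m: "m \<ge> m0" "dst E (X m) z \<omega> < min (h \<omega>) (r \<omega> / 2)" using elim(1) by blast
      have "inverse (real (Suc m)) \<le> inverse (real (Suc m0))" using m(1) by (intro le_imp_inverse_le) auto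
      then have im: "inverse (real (Suc m)) < r \<omega> / 2" using m0 by linarith
      let ?c = "N m \<omega>"
      have Tz: "dst E (T ?c) z \<omega> < h \<omega>" "dst E (T ?c) z \<omega> < r \<omega> / 2" using m(2) elim(2) by auto
      have "dst E (x i) z \<omega> < r \<omega>"
        if "i < length (from_nat ?c :: nat list)" "(from_nat ?c :: nat list) ! i > 0" for i
      proof -
        have "dst E (T ?c) (x i) \<omega> < inverse (real (Suc m))"
          using elim(4) that unfolding near_def by blast
        moreover have "dst E (x i) z \<omega> \<le> dst E (T ?c) (x i) \<omega> + dst E (T ?c) z \<omega>" using elim(3) by blast
        ultimately show ?thesis using im Tz(2) by linarith
      qed
      then have "P ?c \<omega>" using elim(4) Tz(1) by (simp add: P_def)
      then show ?case ..
    qed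
    obtain C where C: "C \<in> M \<rightarrow>\<^sub>M count_space UNIV" and PC: "AE \<omega> in M. P (C \<omega>) \<omega>"
      by (rule measurable_selection[OF _ exP]) (auto simp: P_def)
    \<comment> \<open>The weights of \<open>T c\<close> are kept and each \<open>y i\<close> is
      replaced by \<open>v i\<close>, so convexity of \<open>F z\<close> applies.\<close>
    define Y where "Y = (\<lambda>c. if pos c then avg c v else v0)"
    have Y: "Y c \<in> F z" for c
      using mean_in_convex[OF Fcvx[OF z]] v v0 by (auto simp: Y_def pos_def avg_def)
    have YG: "Y c \<in> G" for c using Y FzG by blast
    \<comment> \<open>\<open>w\<close> is an element of \<open>F z\<close> that turns out to lie in
      the \<open>\<delta>\<close>-ball around \<open>z\<close>, which was chosen to miss
      \<open>F z\<close>.\<close>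
    define w where "w = select M E C Y"
    have w: "w \<in> F z" unfolding w_def using st z Y C by (rule sigma_stable_value)
    have YT: "AE \<omega> in M. \<forall>c. pos c \<longrightarrow> dst E (Y c) (T c) \<omega>
        \<le> (\<Sum>i<length (from_nat c :: nat list). real (from_nat c ! i) /
            real (sum ((!) (from_nat c)) {..<length (from_nat c :: nat list)}) * dst E (v i) (y i) \<omega>)"
      unfolding AE_all_countable
      using AE_dst_mean_points[of _ v y, OF Gc[OF vG] Gc[OF y(2)]] by (auto simp: Y_def T_def avg_def)
    have vy': "AE \<omega> in M. \<forall>i. dst E (x i) z \<omega> < r \<omega> \<longrightarrow> dst E (v i) (y i) \<omega> < h \<omega>"
      unfolding AE_all_countable
    proof
      fix i show "AE \<omega> in M. dst E (x i) z \<omega> < r \<omega> \<longrightarrow> dst E (v i) (y i) \<omega> < h \<omega>"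
        using vy[of i] AE_dst_commute[OF Gc[OF vG] Gc[OF y(2)], of i i] by eventually_elim simp
    qed
    have "AE \<omega> in M. \<forall>c. dst E (Y c) z \<omega> \<le> dst E (Y c) (T c) \<omega> + dst E (T c) z \<omega>"
      unfolding AE_all_countable using AE_dst_triangle[OF Gc[OF YG] Gc[OF TG] zc] by blast
    then have "AE \<omega> in M. dst E w z \<omega> < \<delta> \<omega>"
      using AE_dst_select_left[of G Y C z, OF G YG C zc, folded w_def] PC YT vy'
    proof eventually_elim
      case (elim \<omega>)
      define l where "l = (from_nat (C \<omega>) :: nat list)"
      define Q where "Q = sum ((!) l) {..<length l}"
      have Q: "Q > 0" and near: "\<And>i. i < length l \<Longrightarrow> l ! i > 0 \<Longrightarrow> dst E (x i) z \<omega> < r \<omega>"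
        using elim(3) by (auto simp: P_def pos_def l_def Q_def)
      have "dst E (Y (C \<omega>)) (T (C \<omega>)) \<omega> \<le> (\<Sum>i<length l. real (l ! i) / real Q * dst E (v i) (y i) \<omega>)"
        using elim(3,4) by (simp add: P_def l_def Q_def)
      also have "\<dots> \<le> (\<Sum>i<length l. real (l ! i) / real Q * h \<omega>)"
      proof (rule sum_mono)
        fix i assume i: "i \<in> {..<length l}"
        show "real (l ! i) / real Q * dst E (v i) (y i) \<omega> \<le> real (l ! i) / real Q * h \<omega>"
        \<comment> \<open>Closeness of \<open>v i\<close> to \<open>y i\<close> is known only for
          positive weights; the other terms vanish.\<close>
        proof (cases "l ! i > 0")
          case True
          then have "dst E (v i) (y i) \<omega> < h \<omega>" using near i elim(5) by blast
          then show ?thesis by (intro mult_left_mono) auto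
        qed simp
      qed
      also have "\<dots> = real Q / real Q * h \<omega>"
        by (simp only: sum_distrib_right sum_divide_distrib Q_def of_nat_sum)
      also have "\<dots> = h \<omega>" using Q by simp
      finally have "dst E (Y (C \<omega>)) (T (C \<omega>)) \<omega> \<le> h \<omega>" .
      moreover have "dst E (T (C \<omega>)) z \<omega> < h \<omega>" using elim(3) by (simp add: P_def)
      moreover have "dst E (Y (C \<omega>)) z \<omega> \<le> dst E (Y (C \<omega>)) (T (C \<omega>)) \<omega> + dst E (T (C \<omega>)) z \<omega>"
        using elim(1) by blast
      ultimately show ?case using elim(2) by (simp add: h_def)
    qed
    then have "w \<in> carrier E - F z" using \<delta>F w FzG Gc by blast
    then show False using w by blast
  qed
  then show ?thesis using z by blast
qed

end

theorem theorem2p9: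
  fixes M :: "'a measure"
    and E :: "('a, 'k::{real_normed_field, second_countable_topology}, 'e, 'z) rn_module_scheme"
    and G :: "'e set"
    and F :: "'e \<Rightarrow> 'e set"
  assumes "rn_module M E"
    and "G \<subseteq> carrier E"
    and "random_seq_compact M E G"
    and "L0_convex M E G"
    and "\<And>x. x \<in> G \<Longrightarrow> F x \<noteq> {} \<and> F x \<subseteq> G"
    and "sigma_stable_map M E E G F"
    and "Tc_usc M E E G F"
    and "\<And>x. x \<in> G \<Longrightarrow> closedin (Tc_topology M E) (F x)"
    and "\<And>x. x \<in> G \<Longrightarrow> L0_convex M E (F x)"
  shows "\<exists>x0\<in>G. x0 \<in> F x0"
  using rn_module.random_kakutani[OF assms(1,3-9)] .

end
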